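(* Let $p,q$ be positive integers and let $\mathrm{SPK}_{p,q}$ be the complete split graph, with $m=pq+\binom{p}{2}$ edges. If $q\ge 4p+1$ then $$\delta(\mathcal{A}(\mathrm{SPK}_{p,q}))=2pq+\binom{p}{2}=2m-\binom{p}{2},$$ and otherwise $$\delta(\mathcal{A}(\mathrm{SPK}_{p,q}))=pq+\left\lfloor\tfrac12\binom{q}{2}\right\rfloor+\binom{p}{2}\le 2m.$$
   Context: The complete split graph $\mathrm{SPK}_{p,q}$ has vertex set $P\cup Q$ with $|P|=p$, $|Q|=q$, $P\cap Q=\emptyset$, where $P$ induces a clique, $Q$ induces an independent set, and every vertex of $P$ is adjacent to every vertex of $Q$. For a connected graph $G=(V,E)$, a search tree on $G$ is a rooted tree with vertex set $V$ defined recursively: its root is some vertex $r\in V$, and $r$ is joined to the roots of search trees on each connected component of $G-r$. The tubes of a search tree are the vertex sets of its subtrees. Two search trees on $G$ are related by a rotation if their sets of tubes have symmetric difference of size exactly two. The graph associahedron $\mathcal{A}(G)$ is a polytope whose skeleton is isomorphic to the graph on search trees of $G$ with adjacency given by rotations; $\delta(\mathcal{A}(G))$ is the diameter of this graph. *)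

theory Defs
  imports Main "HOL-Library.FSet" "HOL-Library.Extended_Nat"
begin

text \<open>A simple graph is a pair of a vertex set and a set of two-element vertex sets.\<close>

type_synonym 'a sgraph = "'a set \<times> 'a set set"

abbreviation verts :: "'a sgraph \<Rightarrow> 'a set" where
  "verts G \<equiv> fst G"

abbreviation edges :: "'a sgraph \<Rightarrow> 'a set set" where
  "edges G \<equiv> snd G"

definition adjacency :: "'a sgraph \<Rightarrow> ('a \<times> 'a) set" where
  "adjacency G = {(u, v). {u, v} \<in> edges G}"

definition induced :: "'a sgraph \<Rightarrow> 'a set \<Rightarrow> 'a sgraph" where
  "induced G W = (W, {e \<in> edges G. e \<subseteq> W})"

definition delete_vertex :: "'a sgraph \<Rightarrow> 'a \<Rightarrow> 'a sgraph" where
  "delete_vertex G r = induced G (verts G - {r})"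

definition components :: "'a sgraph \<Rightarrow> 'a set set" where
  "components G =
     verts G // {(u, v). u \<in> verts G \<and> v \<in> verts G \<and> (u, v) \<in> (adjacency G)\<^sup>*}"

text \<open>The infimum of the empty set in \<^typ>\<open>enat\<close> is \<open>\<infinity>\<close>, so the distance between
  vertices not joined by a walk, and the diameter of a disconnected graph, are infinite.\<close>

definition graph_dist :: "'a sgraph \<Rightarrow> 'a \<Rightarrow> 'a \<Rightarrow> enat" where
  "graph_dist G u v = (INF n \<in> {n. (u, v) \<in> adjacency G ^^ n}. enat n)"

definition graph_diameter :: "'a sgraph \<Rightarrow> enat" where
  "graph_diameter G = (SUP u \<in> verts G. SUP v \<in> verts G. graph_dist G u v)"

definition complete_split_graph :: "'a set \<Rightarrow> 'a set \<Rightarrow> 'a sgraph" where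
  "complete_split_graph P Q =
     (P \<union> Q, {{u, v} |u v. u \<in> P \<and> v \<in> P \<and> u \<noteq> v} \<union> {{u, v} |u v. u \<in> P \<and> v \<in> Q})"

text \<open>Rooted trees with unordered children. The generated function \<open>set_rtree\<close> is the
  vertex set.\<close>

datatype 'a rtree = Node 'a "'a rtree fset"

primrec subtrees :: "'a rtree \<Rightarrow> 'a rtree set" where
  "subtrees (Node r ts) = insert (Node r ts) (\<Union> (fset (subtrees |`| ts)))"

definition tubes :: "'a rtree \<Rightarrow> 'a set set" where
  "tubes t = set_rtree ` subtrees t"

text \<open>Meant for connected \<open>G\<close>. The function \<open>f\<close> chooses a search tree for each connected
  component \<open>C\<close> of \<open>G - r\<close>.\<close>

inductive search_tree :: "'a sgraph \<Rightarrow> 'a rtree \<Rightarrow> bool" where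
  "\<lbrakk>r \<in> verts G;
    \<forall>C \<in> components (delete_vertex G r). search_tree (induced G C) (f C);
    fset ts = f ` components (delete_vertex G r)\<rbrakk>
   \<Longrightarrow> search_tree G (Node r ts)"

definition rotation :: "'a rtree \<Rightarrow> 'a rtree \<Rightarrow> bool" where
  "rotation t t' \<longleftrightarrow> card ((tubes t - tubes t') \<union> (tubes t' - tubes t)) = 2"

text \<open>The skeleton of the graph associahedron of \<open>G\<close>, up to isomorphism.\<close>

definition rotation_graph :: "'a sgraph \<Rightarrow> 'a rtree sgraph" where
  "rotation_graph G =
     ({t. search_tree G t},
      {{t, t'} |t t'. search_tree G t \<and> search_tree G t' \<and> rotation t t'})"

definition associahedron_diameter :: "'a sgraph \<Rightarrow> enat" where
  "associahedron_diameter G = graph_diameter (rotation_graph G)"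

end

theory Submission
  imports Defs
begin

text \<open>A search tree on the complete split graph is a permutation of \<open>P \<union> Q\<close> in which the vertices
  after the last element of \<open>P\<close> are the leaves, so that their order is irrelevant. A rotation
  transposes two neighbours in such a permutation.

  Upper bounds: sorting directly costs one rotation per inversion, while taking a detour through a
  tree in which all of \<open>Q\<close> are leaves costs, besides the inversions inside \<open>P\<close>, one rotation
  for each vertex of \<open>P\<close> below a vertex of \<open>Q\<close> in either tree. The detour gives the first bound, and
  the mean of both routes the second.

  Lower bounds: along a walk let \<open>S\<close> be the set of vertices of \<open>Q\<close> that have been a leaf. Each
  element of \<open>S\<close> had to go below all of \<open>P\<close>, and only pairs inside \<open>S\<close> can be reversed for free.
  Start with \<open>Q\<close> above \<open>P\<close>, and end with both orders reversed and the elements of \<open>Q\<close> inserted at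
  almost equal heights whose sum is \<open>\<lfloor>(q choose 2) / 2\<rfloor>\<close> (or, for large \<open>q\<close>, with \<open>Q\<close> again
  above \<open>P\<close>); then no choice of \<open>S\<close> beats the two upper bounds.\<close>

section \<open>Search trees as permutations\<close>

text \<open>\<open>P\<close> holds the clique vertices not yet removed. Once the root is the last of
  them, the remaining graph has no edges and the rest of the word becomes a set of leaves. The value
  at \<open>[]\<close> is never reached as long as \<open>P\<close> is a nonempty subset of the
  word.\<close>

fun split_tree :: "'a set \<Rightarrow> 'a list \<Rightarrow> 'a rtree" where
  "split_tree P [] = undefined"
| "split_tree P (x # w) =
     Node x (if P \<subseteq> {x} then (\<lambda>z. Node z {||}) |`| fset_of_list w else {|split_tree (P - {x}) w|})"

lemma set_split_tree:
  "P \<subseteq> set w \<Longrightarrow> P \<noteq> {} \<Longrightarrow> set_rtree (split_tree P w) = set w"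
proof (induction P w rule: split_tree.induct)
  case (2 P x w)
  show ?case
  proof (cases "P \<subseteq> {x}")
    case False
    then have "P - {x} \<subseteq> set w" "P - {x} \<noteq> {}" using 2 by auto
    then show ?thesis using 2(1) False by simp
  qed (simp add: fset_of_list.rep_eq)
qed simp

lemma tubes_Node:
  "tubes (Node x ts) = insert (set_rtree (Node x ts)) (\<Union>t\<in>fset ts. tubes t)"
  by (auto simp: tubes_def)

lemma tubes_split_tree_Cons:
  assumes "P \<subseteq> set (x # w)" "P \<noteq> {}"
  shows "tubes (split_tree P (x # w)) = insert (set (x # w))
    (if P \<subseteq> {x} then (\<lambda>z. {z}) ` set w else tubes (split_tree (P - {x}) w))"
  using set_split_tree[OF assms]
  by (auto simp: tubes_Node fset_of_list.rep_eq)

declare split_tree.simps(2) [simp del]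

lemma tube_subset:
  "P \<subseteq> set w \<Longrightarrow> P \<noteq> {} \<Longrightarrow> T \<in> tubes (split_tree P w) \<Longrightarrow> T \<subseteq> set w"
proof (induction P w rule: split_tree.induct)
  case (2 P x w)
  show ?case
  proof (cases "P \<subseteq> {x}")
    case False
    then have "P - {x} \<subseteq> set w" "P - {x} \<noteq> {}" using 2 by auto
    then show ?thesis using 2 False by (auto simp: tubes_split_tree_Cons)
  next
    case True
    then show ?thesis using 2 by (auto simp: tubes_split_tree_Cons)
  qed
qed simp

lemma full_tube: "P \<subseteq> set w \<Longrightarrow> P \<noteq> {} \<Longrightarrow> set w \<in> tubes (split_tree P w)"
  by (cases w) (auto simp: tubes_split_tree_Cons)

text \<open>Two permutations have the same tree iff they differ only in the order of the leaves.\<close>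

definition tail_eq :: "'a set \<Rightarrow> 'a list \<Rightarrow> 'a list \<Rightarrow> bool" where
  "tail_eq P w v \<longleftrightarrow>
     (\<exists>u c c'. w = u @ c \<and> v = u @ c' \<and> set c = set c' \<and> distinct c \<and> distinct c' \<and> set c \<inter> P = {})"

lemma tail_eqE:
  assumes "tail_eq P w v"
  obtains u c c' where "w = u @ c" "v = u @ c'" "set c = set c'"
    "distinct c" "distinct c'" "set c \<inter> P = {}"
  using assms unfolding tail_eq_def by (elim exE conjE) (rule that)

lemma tail_eq_refl: "tail_eq P w w"
  unfolding tail_eq_def by (intro exI[of _ w] exI[of _ "[]"]) simp

lemma tail_eq_sym: "tail_eq P w v \<Longrightarrow> tail_eq P v w"
  unfolding tail_eq_def
proof (elim exE conjE)
  fix u c c'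
  assume "w = u @ c" "v = u @ c'" "set c = set c'" "distinct c" "distinct c'" "set c \<inter> P = {}"
  then show "\<exists>u c c'. v = u @ c \<and> w = u @ c' \<and> set c = set c' \<and>
      distinct c \<and> distinct c' \<and> set c \<inter> P = {}"
    by (intro exI[of _ u] exI[of _ c'] exI[of _ c]) simp
qed

lemma tail_eq_Cons: "tail_eq (P - {x}) w v \<Longrightarrow> x \<notin> set w \<Longrightarrow> tail_eq P (x # w) (x # v)"
  unfolding tail_eq_def
proof (elim exE conjE)
  fix u c c'
  assume h: "w = u @ c" "v = u @ c'" "set c = set c'" "distinct c" "distinct c'"
    "set c \<inter> (P - {x}) = {}" "x \<notin> set w"
  then have "set c \<inter> P = {}" by auto
  then show "\<exists>u c c'. x # w = u @ c \<and> x # v = u @ c' \<and> set c = set c' \<and>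
      distinct c \<and> distinct c' \<and> set c \<inter> P = {}"
    using h(1-5) by (intro exI[of _ "x # u"] exI[of _ c] exI[of _ c']) simp
qed

lemma tail_eq_append:
  "set w = set v \<Longrightarrow> distinct w \<Longrightarrow> distinct v \<Longrightarrow> set w \<inter> P = {} \<Longrightarrow> tail_eq P (u @ w) (u @ v)"
  unfolding tail_eq_def by (intro exI[of _ u] exI[of _ w] exI[of _ v]) simp

lemma tail_eq_distinct: "tail_eq P w v \<Longrightarrow> distinct w \<Longrightarrow> distinct v \<and> set v = set w"
  unfolding tail_eq_def by (elim exE conjE) simp

section \<open>Recovering a word from its tubes\<close>

lemma tubes_split_tree_tl:
  assumes "P \<subseteq> set (x # w)" "\<not> P \<subseteq> {x}" "distinct (x # w)"
  shows "tubes (split_tree (P - {x}) w) = tubes (split_tree P (x # w)) - {set (x # w)}"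
proof -
  have "P - {x} \<subseteq> set w" "P - {x} \<noteq> {}" using assms by auto
  then have "set (x # w) \<notin> tubes (split_tree (P - {x}) w)"
    using tube_subset[of "P - {x}" w "set (x # w)"] assms(3) by auto
  then show ?thesis using assms tubes_split_tree_Cons[of P x w] by auto
qed

text \<open>Every tube other than the full one lies inside \<open>set b\<close>, which misses the
  root.\<close>

lemma tubes_without_root:
  assumes "P \<subseteq> set (y # b)" "P \<noteq> {}" "distinct (y # b)"
    and "T \<in> tubes (split_tree P (y # b))" "y \<in> T"
  shows "T = set (y # b)"
proof (rule ccontr)
  assume ne: "T \<noteq> set (y # b)"
  show False
  proof (cases "P \<subseteq> {y}")
    case True
    then show ?thesis using assms ne by (auto simp: tubes_split_tree_Cons)
  next
    case False
    then have "T \<in> tubes (split_tree (P - {y}) b)"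
      using assms ne by (auto simp: tubes_split_tree_Cons)
    moreover have "P - {y} \<subseteq> set b" "P - {y} \<noteq> {}" using assms False by auto
    ultimately show False using tube_subset[of "P - {y}" b T] assms by auto
  qed
qed

text \<open>The tube of the root's only child tells two trees with different roots apart: it
  contains the root \<open>y\<close> of the other tree, where only the full tube does.\<close>

lemma new_tube:
  assumes "P \<subseteq> set (x # a)" "P \<noteq> {}" "distinct (x # a)" "distinct (y # b)"
    and "set (x # a) = set (y # b)" "x \<noteq> y" "\<not> P \<subseteq> {x}"
  shows "set a \<in> tubes (split_tree P (x # a))" "set a \<notin> tubes (split_tree P (y # b))"
proof -
  have "P - {x} \<subseteq> set a" "P - {x} \<noteq> {}" using assms by auto
  then show "set a \<in> tubes (split_tree P (x # a))"
    using assms full_tube[of "P - {x}" a] by (simp add: tubes_split_tree_Cons)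
  show "set a \<notin> tubes (split_tree P (y # b))"
  proof
    assume "set a \<in> tubes (split_tree P (y # b))"
    moreover have "y \<in> set a" using assms by auto
    ultimately have "set a = set (y # b)"
      using tubes_without_root[of P y b "set a"] assms by auto
    then show False using assms by auto
  qed
qed

text \<open>Replaces \<open>new_tube\<close> when \<open>P = {x}\<close>: the tree is then a star
  around \<open>x\<close>, and the leaf \<open>{y}\<close> takes over the role of the child's
  tube.\<close>

lemma new_leaf:
  assumes "distinct (x # a)" "distinct (y # b)" "set (x # a) = set (y # b)" "x \<noteq> y"
  shows "{y} \<in> tubes (split_tree {x} (x # a))" "{y} \<notin> tubes (split_tree {x} (y # b))"
proof -
  show "{y} \<in> tubes (split_tree {x} (x # a))"
    using assms by (auto simp: tubes_split_tree_Cons)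
  show "{y} \<notin> tubes (split_tree {x} (y # b))"
  proof
    assume "{y} \<in> tubes (split_tree {x} (y # b))"
    then have "{y} = set (y # b)"
      using tubes_without_root[of "{x}" y b "{y}"] assms by auto
    then show False using assms by (metis insertI1 list.simps(15) singletonD)
  qed
qed

text \<open>Different roots would give a tube belonging to one tree only. So the roots agree, and
  removing the full tube passes to the child, until a star is left in which the order of the leaves
  is lost.\<close>

lemma tubes_split_tree_inj:
  assumes "P \<subseteq> set w" "P \<noteq> {}" "distinct w" "distinct w'" "set w = set w'"
    and "tubes (split_tree P w) = tubes (split_tree P w')"
  shows "tail_eq P w w'"
  using assms
proof (induction w arbitrary: P w')
  case (Cons x a)
  obtain y b where w': "w' = y # b" using Cons.prems by (cases w') auto
  have xy: "x = y"
  proof (rule ccontr)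
    assume ne: "x \<noteq> y"
    consider "P = {x}" | "P = {y}" | "\<not> P \<subseteq> {x}" "\<not> P \<subseteq> {y}" using Cons.prems(2) by auto
    then show False
    proof cases
      case 1
      then show ?thesis using new_leaf[of x a y b] Cons.prems ne w' by auto
    next
      case 2
      then show ?thesis using new_leaf[of y b x a] Cons.prems ne w' by auto
    next
      case 3
      then show ?thesis using new_tube[of P x a y b] Cons.prems ne w' by auto
    qed
  qed
  have ab: "set a = set b" using Cons.prems w' xy by auto
  show ?case
  proof (cases "P \<subseteq> {x}")
    case True
    then show ?thesis using tail_eq_append[of a b P "[x]"] ab Cons.prems w' xy by auto
  next
    case False
    then have P': "P - {x} \<subseteq> set a" "P - {x} \<noteq> {}" using Cons.prems by auto
    have "tubes (split_tree (P - {x}) a) = tubes (split_tree (P - {x}) b)"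
      using tubes_split_tree_tl[of P x a] tubes_split_tree_tl[of P y b] Cons.prems w' xy False by auto
    then have "tail_eq (P - {x}) a b" using Cons.IH[of "P - {x}" b] P' ab Cons.prems w' by auto
    then show ?thesis using tail_eq_Cons[of P x a b] w' xy Cons.prems by auto
  qed
qed simp

lemma split_tree_tail_eq:
  assumes "tail_eq P w v" "P \<subseteq> set w" "P \<noteq> {}"
  shows "split_tree P w = split_tree P v"
proof -
  obtain u c c' where u: "w = u @ c" "v = u @ c'" "set c = set c'" "set c \<inter> P = {}"
    using assms(1) by (rule tail_eqE)
  \<comment> \<open>So the recursion ends inside \<open>u\<close>, and \<open>c\<close> enters only
    through the set of leaves.\<close>
  have "P \<subseteq> set u" using u(1,4) assms(2) by auto
  moreover have "P \<subseteq> set u \<Longrightarrow> P \<noteq> {} \<Longrightarrow> split_tree P (u @ c) = split_tree P (u @ c')"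
  proof (induction u arbitrary: P)
    case (Cons x u)
    have eq: "fset_of_list (u @ c) = fset_of_list (u @ c')"
      using u(3) by (simp add: fset_eq_iff fset_of_list_elem)
    show ?case
    proof (cases "P \<subseteq> {x}")
      case True
      then show ?thesis using eq by (simp only: append_Cons split_tree.simps if_True)
    next
      case False
      then have "P - {x} \<subseteq> set u" "P - {x} \<noteq> {}" using Cons.prems by auto
      then show ?thesis using Cons.IH[of "P - {x}"] by (simp add: split_tree.simps(2) False)
    qed
  qed simp
  ultimately show ?thesis using assms(3) u(1,2) by simp
qed

section \<open>Rotations as adjacent transpositions\<close>

text \<open>Turns one known witness on each side into the complete list of tubes lost and gained by
  a rotation.\<close>

lemma symmetric_difference_two:
  assumes "card ((A - B) \<union> (B - A)) = 2" "a \<in> A" "a \<notin> B" "b \<in> B" "b \<notin> A"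
  shows "A - B = {a}" "B - A = {b}"
proof -
  let ?D = "(A - B) \<union> (B - A)"
  have "finite ?D" using assms(1) by (metis card.infinite zero_neq_numeral)
  moreover have "a \<noteq> b" using assms by blast
  then have "{a, b} \<subseteq> ?D" "card {a, b} = 2" using assms by auto
  ultimately have "{a, b} = ?D" using assms(1) by (intro card_subset_eq) auto
  then have "z \<in> A - B \<longleftrightarrow> z \<in> {a}" "z \<in> B - A \<longleftrightarrow> z \<in> {b}" for z
    using assms(2-5) by (metis DiffI DiffD1 DiffD2 UnCI UnE insertE insertI1 singletonD)+
  then show "A - B = {a}" "B - A = {b}" by (simp_all add: set_eq_iff)
qed

definition adjacent_swap :: "'a list \<Rightarrow> 'a list \<Rightarrow> bool" where
  "adjacent_swap w v \<longleftrightarrow> (\<exists>u x y c. w = u @ x # y # c \<and> v = u @ y # x # c)"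

lemma adjacent_swap_sym: "adjacent_swap w v \<Longrightarrow> adjacent_swap v w"
  unfolding adjacent_swap_def by blast

lemma adjacent_swap_Cons: "adjacent_swap w v \<Longrightarrow> adjacent_swap (x # w) (x # v)"
  unfolding adjacent_swap_def by (metis append_Cons)

lemma rotation_sym: "rotation t t' \<longleftrightarrow> rotation t' t"
  unfolding rotation_def by (simp add: Un_commute)

text \<open>In the star around \<open>x\<close> only the full tube contains \<open>x\<close>. If
  \<open>x\<close> came later than second in the other word, both \<open>set b\<close> and
  \<open>set b'\<close> would be new tubes, but a rotation creates just one.\<close>

lemma rotation_singleton_head:
  assumes "distinct (x # a)" "distinct (y # b)" "set (x # a) = set (y # b)" "x \<noteq> y"
    and rot: "rotation (split_tree {x} (x # a)) (split_tree {x} (y # b))"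
  shows "\<exists>b'. b = x # b'"
proof -
  obtain b1 b' where b: "b = b1 # b'" using assms by (cases b) auto
  have "b1 = x"
  proof (rule ccontr)
    assume ne: "b1 \<noteq> x"
    let ?t = "tubes (split_tree {x} (x # a))" and ?t' = "tubes (split_tree {x} (y # b))"
    have xb': "{x} \<subseteq> set b'" using assms(3,4) ne b by auto
    have t': "?t' = insert (set (y # b)) (insert (set b) (tubes (split_tree {x} b')))"
      using tubes_split_tree_Cons[of "{x}" y b] tubes_split_tree_Cons[of "{x}" b1 b'] xb' assms(4) ne b
      by simp
    have "set b' \<in> ?t'" "set b \<in> ?t'" using full_tube[OF xb'] t' by auto
    moreover have "set b' \<notin> ?t" "set b \<notin> ?t"
      using tubes_without_root[of "{x}" x a] assms xb' b by auto
    moreover have "{y} \<in> ?t" "{y} \<notin> ?t'" using new_leaf[OF assms(1-4)] by auto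
    ultimately have "set b' = set b"
      using symmetric_difference_two(2)[OF rot[unfolded rotation_def], of "{y}"]
      by (metis DiffI singletonD)
    then show False using b assms(2) by auto
  qed
  then show ?thesis using b by auto
qed

text \<open>Describes what a rotation at the root leaves alone: the tubes \<open>R\<close> below the
  first two vertices. Their union reveals which vertices come after these two.\<close>

lemma tubes_two_roots:
  assumes "P \<subseteq> set (x # a1 # a)" "P \<noteq> {}" "distinct (x # a1 # a)" "\<not> P \<subseteq> {x}"
  defines "R \<equiv> tubes (split_tree P (x # a1 # a)) - {set (x # a1 # a), set (a1 # a)}"
  shows "\<Union>R = set a"
    and "R = (if P \<subseteq> {x, a1} then (\<lambda>z. {z}) ` set a else tubes (split_tree (P - {x, a1}) a))"
proof -
  have 1: "P - {x} \<subseteq> set (a1 # a)" "P - {x} \<noteq> {}" using assms by auto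
  have 2: "tubes (split_tree P (x # a1 # a)) - {set (x # a1 # a)} = tubes (split_tree (P - {x}) (a1 # a))"
    using tubes_split_tree_tl assms by metis
  have sub: "(P - {x} \<subseteq> {a1}) = (P \<subseteq> {x, a1})" by auto
  have PP: "P - {x} - {a1} = P - {x, a1}" by auto
  have R: "R = tubes (split_tree (P - {x}) (a1 # a)) - {set (a1 # a)}"
    using 2 unfolding R_def by blast
  show *: "R = (if P \<subseteq> {x, a1} then (\<lambda>z. {z}) ` set a else tubes (split_tree (P - {x, a1}) a))"
  proof (cases "P \<subseteq> {x, a1}")
    case True
    have "set (a1 # a) \<notin> (\<lambda>z. {z}) ` set a" using assms(3) by auto
    then show ?thesis using True R tubes_split_tree_Cons[OF 1] sub by auto
  next
    case False
    then have "tubes (split_tree (P - {x} - {a1}) a) = tubes (split_tree (P - {x}) (a1 # a)) - {set (a1 # a)}"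
      using tubes_split_tree_tl[of "P - {x}" a1 a] 1 assms(3) sub by auto
    then show ?thesis using R False PP by simp
  qed
  show "\<Union>R = set a"
  proof (cases "P \<subseteq> {x, a1}")
    case False
    then have "P - {x, a1} \<subseteq> set a" "P - {x, a1} \<noteq> {}" using assms(1) by auto
    then show ?thesis
      using * False full_tube[of "P - {x, a1}" a] tube_subset[of "P - {x, a1}" a] by auto
  qed (use * in auto)
qed

text \<open>A common root is stripped by induction; with different roots the first two letters are
  exchanged. Words equivalent under \<open>tail_eq\<close> are allowed because the leaf that moves
  need not stand next to the last clique vertex.\<close>

lemma rotation_imp_swap:
  assumes "P \<subseteq> set w" "P \<noteq> {}" "distinct w" "distinct w'" "set w = set w'"
    and "rotation (split_tree P w) (split_tree P w')"
  shows "\<exists>v v'. tail_eq P w v \<and> tail_eq P w' v' \<and> adjacent_swap v v'"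
  using assms
proof (induction w arbitrary: P w')
  case (Cons x a)
  obtain y b where w': "w' = y # b" using Cons.prems by (cases w') auto
  note prems = Cons.prems[unfolded w']
  \<comment> \<open>\<open>y\<close> is one of the leaves below \<open>x\<close>, so it may first be
    brought to the front of the leaves.\<close>
  have leaf_case: "\<exists>v. tail_eq {x} (x # a) v \<and> adjacent_swap v (y # b)"
    if asm: "distinct (x # a)" "distinct (y # b)" "set (x # a) = set (y # b)" "x \<noteq> y"
      "rotation (split_tree {x} (x # a)) (split_tree {x} (y # b))" for x y :: 'a and a b
  proof -
    obtain b' where b: "b = x # b'" using rotation_singleton_head[OF asm] by blast
    have "set a = set (y # b')" using asm b by auto
    moreover have "distinct a" "distinct (y # b')" "set a \<inter> {x} = {}" using asm(1,2) b by auto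
    ultimately have "tail_eq {x} ([x] @ a) ([x] @ y # b')" by (rule tail_eq_append)
    then have "tail_eq {x} (x # a) (x # y # b')" by simp
    moreover have "adjacent_swap (x # y # b') (y # b)"
      unfolding adjacent_swap_def b by (metis append_Nil)
    ultimately show ?thesis by blast
  qed
  consider "x = y" | "x \<noteq> y" "P = {x}" | "x \<noteq> y" "P = {y}" | "x \<noteq> y" "\<not> P \<subseteq> {x}" "\<not> P \<subseteq> {y}"
    using Cons.prems(2) by auto
  then show ?case
  proof cases
    case 1
    then have ab: "set a = set b" using prems by auto
    \<comment> \<open>If the common root were the last clique vertex, both words would have the same
      tree.\<close>
    have nP: "\<not> P \<subseteq> {x}"
    proof
      assume P: "P \<subseteq> {x}"
      have "tail_eq P (x # a) (y # b)"
        using tail_eq_append[of a b P "[x]"] ab P 1 prems by auto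
      then show False
        using split_tree_tail_eq prems unfolding rotation_def by fastforce
    qed
    then have P': "P - {x} \<subseteq> set a" "P - {x} \<noteq> {}" using prems by auto
    \<comment> \<open>The full tube is common to both trees, so removing it keeps the symmetric
      difference.\<close>
    have "rotation (split_tree (P - {x}) a) (split_tree (P - {x}) b)"
    proof -
      have "A - {V} - (B - {V}) \<union> (B - {V} - (A - {V})) = A - B \<union> (B - A)"
        if "V \<in> A" "V \<in> B" for A B and V :: "'a set"
        using that by auto
      then show ?thesis
        using prems(6) full_tube[OF prems(1,2)] full_tube[of P "y # b"] prems nP 1
          tubes_split_tree_tl[of P x a] tubes_split_tree_tl[of P y b]
        unfolding rotation_def by auto
    qed
    then obtain v v' where v: "tail_eq (P - {x}) a v" "tail_eq (P - {x}) b v'" "adjacent_swap v v'"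
      using Cons.IH[OF P', of b] ab prems by auto
    then show ?thesis
      using tail_eq_Cons[OF v(1)] tail_eq_Cons[OF v(2)] adjacent_swap_Cons[OF v(3), of x] prems(3,4) 1 w'
      by (intro exI[of _ "x # v"] exI[of _ "x # v'"]) simp
  next
    case 2
    then show ?thesis using leaf_case[of x a y b] prems w' tail_eq_refl by metis
  next
    case 3
    then show ?thesis
      using leaf_case[of y b x a] prems w' tail_eq_refl rotation_sym adjacent_swap_sym by metis
  next
    case 4
    let ?t = "tubes (split_tree P (x # a))" and ?t' = "tubes (split_tree P (y # b))"
    have Py: "P \<subseteq> set (y # b)" using prems by auto
    obtain a1 a' b1 b' where a: "a = a1 # a'" and b: "b = b1 # b'"
      using prems 4 by (cases a; cases b) auto
    \<comment> \<open>The two child tubes account for the whole difference, hence the tubes below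
      the first two vertices coincide.\<close>
    have "?t - ?t' = {set a}" "?t' - ?t = {set b}"
      using symmetric_difference_two[OF prems(6)[unfolded rotation_def],
          OF new_tube[OF prems(1-5) 4(1,2)]
            new_tube[OF Py prems(2,4,3) prems(5)[symmetric] 4(1)[symmetric] 4(3)]]
      by simp_all
    then have R: "?t - {set (x # a), set a} = ?t' - {set (y # b), set b}"
      using prems(5) by blast
    have U: "set a' = set b'"
      using tubes_two_roots(1)[of P x a1 a'] tubes_two_roots(1)[of P y b1 b'] R a b prems Py 4 by auto
    \<comment> \<open>The words have the same letters and the same set of letters after the second,
      so their first two letters are the same pair in opposite order.\<close>
    have a1: "a1 = y" "b1 = x" using U prems(3-5) 4 a b by auto
    have comm: "{y, x} = {x, y}" by auto
    have "tail_eq P (y # b) (y # x # a')"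
    proof (cases "P \<subseteq> {x, y}")
      case True
      have "distinct b'" "distinct a'" "set b' \<inter> P = {}" using True a b a1 prems(3,4) by auto
      then have "tail_eq P ([y, x] @ b') ([y, x] @ a')" by (rule tail_eq_append[OF U[symmetric]])
      then show ?thesis using a1 b by simp
    next
      case False
      have "tubes (split_tree (P - {x, y}) b') = tubes (split_tree (P - {x, y}) a')"
        using tubes_two_roots(2)[of P x a1 a'] tubes_two_roots(2)[of P y b1 b'] R a b prems Py 4 a1 False
        by (simp add: comm)
      moreover have "P - {x, y} \<subseteq> set b'" "P - {x, y} \<noteq> {}" using False Py a1 b by auto
      ultimately have "tail_eq (P - {x, y}) b' a'"
        using U prems(3,4) a b by (intro tubes_split_tree_inj) simp_all
      moreover have "P - {y} - {x} = P - {x, y}" by auto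
      ultimately have "tail_eq (P - {y} - {x}) b' a'" by simp
      then show ?thesis using a1 b prems(4) by (auto intro!: tail_eq_Cons)
    qed
    moreover have "adjacent_swap (x # a) (y # x # a')"
      unfolding adjacent_swap_def a a1 by (metis append_Nil)
    ultimately show ?thesis using tail_eq_refl w' by metis
  qed
qed simp

text \<open>The tube \<open>set (y # c)\<close> is exchanged for \<open>set (x # c)\<close>; when
  \<open>x\<close> or \<open>y\<close> is the only vertex of \<open>P\<close>, a singleton takes the
  place of the tube below it.\<close>

lemma swap_rotation_head:
  assumes "P \<subseteq> set (x # y # c)" "P \<noteq> {}" "distinct (x # y # c)"
  shows "rotation (split_tree P (x # y # c)) (split_tree P (y # x # c))"
proof -
  have leaf: "rotation (split_tree {x} (x # y # c)) (split_tree {x} (y # x # c))"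
    if "distinct (x # y # c)" for x y :: 'a and c
  proof -
    have t: "tubes (split_tree {x} (x # y # c))
        = insert (set (x # y # c)) (insert {y} ((\<lambda>z. {z}) ` set c))"
      "tubes (split_tree {x} (y # x # c))
        = insert (set (x # y # c)) (insert (set (x # c)) ((\<lambda>z. {z}) ` set c))"
      using that by (subst tubes_split_tree_Cons; force simp: tubes_split_tree_Cons)+
    have "{y} \<noteq> set (x # y # c)" "{y} \<noteq> set (x # c)" "{y} \<notin> (\<lambda>z. {z}) ` set c"
      "set (x # c) \<noteq> set (x # y # c)" "set (x # c) \<notin> (\<lambda>z. {z}) ` set c"
      using that by auto
    then have "tubes (split_tree {x} (x # y # c)) - tubes (split_tree {x} (y # x # c)) = {{y}}"
      "tubes (split_tree {x} (y # x # c)) - tubes (split_tree {x} (x # y # c)) = {set (x # c)}"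
      unfolding t by blast+
    then show ?thesis using \<open>{y} \<noteq> set (x # c)\<close> unfolding rotation_def by auto
  qed
  consider "P = {x}" | "P = {y}" | "\<not> P \<subseteq> {x}" "\<not> P \<subseteq> {y}" using assms(2) by auto
  then show ?thesis
  proof cases
    case 1
    then show ?thesis using leaf[of x y c] assms by auto
  next
    case 2
    then show ?thesis using leaf[of y x c] assms rotation_sym by auto
  next
    case 3
    let ?t = "tubes (split_tree P (x # y # c))" and ?t' = "tubes (split_tree P (y # x # c))"
    have P': "P \<subseteq> set (y # x # c)" and c: "{y, x} = {x, y}" "set (y # x # c) = set (x # y # c)"
      using assms by auto
    have d: "distinct (y # x # c)" "x \<noteq> y" "y \<noteq> x" using assms(3) by auto
    have R: "?t - {set (x # y # c), set (y # c)} = ?t' - {set (x # y # c), set (x # c)}"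
      using tubes_two_roots(2)[OF assms 3(1)] tubes_two_roots(2)[OF P' assms(2) d(1) 3(2)]
      by (simp only: c)
    have "set (y # c) \<in> ?t" "set (y # c) \<notin> ?t'" "set (x # c) \<in> ?t'" "set (x # c) \<notin> ?t"
      using new_tube[OF assms d(1) c(2)[symmetric] d(2) 3(1)]
        new_tube[OF P' assms(2) d(1) assms(3) c(2) d(3) 3(2)] by simp_all
    moreover have "set (x # y # c) \<in> ?t" "set (x # y # c) \<in> ?t'"
      using full_tube[OF assms(1,2)] full_tube[OF P' assms(2)] c by simp_all
    moreover have swap: "A - B = {a} \<and> B - A = {b}"
      if "A - {V, a} = B - {V, b}" "a \<in> A" "a \<notin> B" "b \<in> B" "b \<notin> A" "V \<in> A" "V \<in> B"
      for A B and V a b :: "'a set"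
    proof -
      have "z \<in> A - {V, a} \<longleftrightarrow> z \<in> B - {V, b}" for z using that(1) by simp
      then show ?thesis using that(2-) by auto
    qed
    ultimately have "?t - ?t' = {set (y # c)} \<and> ?t' - ?t = {set (x # c)}" using R by (intro swap)
    moreover have "set (y # c) \<noteq> set (x # c)" using assms by auto
    ultimately show ?thesis unfolding rotation_def by simp
  qed
qed

text \<open>Equal trees occur when both swapped vertices stand behind all of \<open>P\<close>.
  Otherwise the common prefix only adds the same tubes to both sides.\<close>

lemma swap_imp_rotation:
  assumes "P \<subseteq> set w" "P \<noteq> {}" "distinct w" "adjacent_swap w w'"
  shows "split_tree P w = split_tree P w' \<or> rotation (split_tree P w) (split_tree P w')"
proof -
  obtain u x y c where "w = u @ x # y # c" "w' = u @ y # x # c"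
    using assms(4) unfolding adjacent_swap_def by blast
  moreover have "P \<subseteq> set (u @ x # y # c) \<Longrightarrow> P \<noteq> {} \<Longrightarrow> distinct (u @ x # y # c) \<Longrightarrow>
    split_tree P (u @ x # y # c) = split_tree P (u @ y # x # c) \<or>
    rotation (split_tree P (u @ x # y # c)) (split_tree P (u @ y # x # c))"
  proof (induction u arbitrary: P)
    case Nil
    then show ?case using swap_rotation_head[of P x y c] by simp
  next
    case (Cons h u)
    let ?w = "u @ x # y # c" and ?w' = "u @ y # x # c"
    have Q: "P \<subseteq> set (h # ?w')" "set ?w = set ?w'" "distinct (h # ?w')" "distinct (h # ?w)"
      using Cons.prems by auto
    show ?case
    proof (cases "P \<subseteq> {h}")
      case True
      then have "tail_eq P (h # ?w) (h # ?w')"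
        using tail_eq_append[of ?w ?w' P "[h]"] Q Cons.prems by auto
      then show ?thesis using split_tree_tail_eq[of P "h # ?w" "h # ?w'"] Cons.prems by auto
    next
      case False
      have P': "P - {h} \<subseteq> set ?w" "P - {h} \<noteq> {}" using Cons.prems False by auto
      have "tubes (split_tree P (h # ?w)) = insert (set (h # ?w)) (tubes (split_tree (P - {h}) ?w))"
        "tubes (split_tree P (h # ?w')) = insert (set (h # ?w)) (tubes (split_tree (P - {h}) ?w'))"
        using tubes_split_tree_Cons[of P h ?w] tubes_split_tree_Cons[of P h ?w'] Cons.prems Q False
        by auto
      moreover have "set (h # ?w) \<notin> tubes (split_tree (P - {h}) ?w)"
        "set (h # ?w) \<notin> tubes (split_tree (P - {h}) ?w')"
        using tube_subset[of "P - {h}" ?w "set (h # ?w)"] tube_subset[of "P - {h}" ?w' "set (h # ?w)"]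
          P' Q by auto
      ultimately have "rotation (split_tree P (h # ?w)) (split_tree P (h # ?w')) \<longleftrightarrow>
          rotation (split_tree (P - {h}) ?w) (split_tree (P - {h}) ?w')"
        unfolding rotation_def by simp
      then show ?thesis
        using Cons.IH[OF P'] Q False by (auto simp: split_tree.simps(2))
    qed
  qed
  ultimately show ?thesis using assms by blast
qed

section \<open>Search trees of the complete split graph\<close>

lemma verts_complete_split_graph [simp]: "verts (complete_split_graph P Q) = P \<union> Q"
  by (simp add: complete_split_graph_def)

lemma adjacency_complete_split_graph:
  assumes "P \<inter> Q = {}"
  shows "(u, v) \<in> adjacency (complete_split_graph P Q) \<longleftrightarrow>
    u \<noteq> v \<and> u \<in> P \<union> Q \<and> v \<in> P \<union> Q \<and> (u \<in> P \<or> v \<in> P)"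
proof -
  have "(u, v) \<in> adjacency (complete_split_graph P Q) \<longleftrightarrow>
    (\<exists>a b. {u, v} = {a, b} \<and> a \<in> P \<and> (b \<in> P \<and> a \<noteq> b \<or> b \<in> Q))"
    unfolding adjacency_def complete_split_graph_def by auto
  also have "\<dots> \<longleftrightarrow> u \<noteq> v \<and> u \<in> P \<union> Q \<and> v \<in> P \<union> Q \<and> (u \<in> P \<or> v \<in> P)"
    using assms by (auto simp: doubleton_eq_iff)
  finally show ?thesis .
qed

lemma induced_complete_split_graph:
  assumes "W \<subseteq> P \<union> Q"
  shows "induced (complete_split_graph P Q) W = complete_split_graph (P \<inter> W) (Q \<inter> W)"
proof -
  have "W = P \<inter> W \<union> Q \<inter> W" using assms by auto
  then show ?thesis
    unfolding induced_def complete_split_graph_def by (auto; blast)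
qed

lemma delete_vertex_complete_split_graph:
  "delete_vertex (complete_split_graph P Q) r = complete_split_graph (P - {r}) (Q - {r})"
proof -
  have "P \<inter> (P \<union> Q - {r}) = P - {r}" "Q \<inter> (P \<union> Q - {r}) = Q - {r}" by auto
  then show ?thesis
    unfolding delete_vertex_def by (subst induced_complete_split_graph) auto
qed

lemma components_complete_split_graph:
  assumes "P \<inter> Q = {}" "P \<noteq> {}"
  shows "components (complete_split_graph P Q) = {P \<union> Q}"
proof -
  let ?A = "adjacency (complete_split_graph P Q)"
  obtain x where x: "x \<in> P" using assms by auto
  have to: "(u, x) \<in> ?A\<^sup>*" "(x, u) \<in> ?A\<^sup>*" if "u \<in> P \<union> Q" for u
    using that x adjacency_complete_split_graph[OF assms(1)]
    by (cases "u = x"; auto intro!: r_into_rtrancl)+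
  have "(u, v) \<in> ?A\<^sup>*" if "u \<in> P \<union> Q" "v \<in> P \<union> Q" for u v
    using to(1)[OF that(1)] to(2)[OF that(2)] by (rule rtrancl_trans)
  then have "{(u, v). u \<in> P \<union> Q \<and> v \<in> P \<union> Q \<and> (u, v) \<in> ?A\<^sup>*} = (P \<union> Q) \<times> (P \<union> Q)" by auto
  then show ?thesis using x unfolding components_def quotient_def by auto
qed

lemma components_edgeless:
  "components (complete_split_graph {} Q) = (\<lambda>z. {z}) ` Q"
proof -
  have "adjacency (complete_split_graph {} Q) = {}"
    using adjacency_complete_split_graph[of "{}" Q] by auto
  then have "{(u, v). u \<in> Q \<and> v \<in> Q \<and> (u, v) \<in> (adjacency (complete_split_graph {} Q))\<^sup>*}
      = Id_on Q" by auto
  then show ?thesis unfolding components_def quotient_def by auto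
qed

lemma search_tree_single_vertex:
  "search_tree (complete_split_graph {} {z}) t \<longleftrightarrow> t = Node z {||}"
proof
  assume "search_tree (complete_split_graph {} {z}) t"
  then show "t = Node z {||}"
    by cases (auto simp: delete_vertex_complete_split_graph components_edgeless)
next
  have "search_tree (complete_split_graph {} {z}) (Node z {||})"
    by (rule search_tree.intros[of _ _ "\<lambda>_. undefined"])
      (auto simp: delete_vertex_complete_split_graph components_edgeless)
  then show "t = Node z {||} \<Longrightarrow> search_tree (complete_split_graph {} {z}) t" by simp
qed

lemma induced_minus_vertex:
  assumes "P \<inter> Q = {}"
  shows "induced (complete_split_graph P Q) (P - {r} \<union> (Q - {r}))
    = complete_split_graph (P - {r}) (Q - {r})"
proof -
  have "P \<inter> (P - {r} \<union> (Q - {r})) = P - {r}" "Q \<inter> (P - {r} \<union> (Q - {r})) = Q - {r}" by auto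
  then show ?thesis by (subst induced_complete_split_graph) auto
qed

lemma induced_vertex:
  assumes "z \<in> Q" "P \<inter> Q = {}"
  shows "induced (complete_split_graph P Q) {z} = complete_split_graph {} {z}"
proof -
  have "P \<inter> {z} = {}" "Q \<inter> {z} = {z}" using assms by auto
  then show ?thesis using assms by (subst induced_complete_split_graph) auto
qed

text \<open>As long as clique vertices remain, deleting the root leaves a connected complete split
  graph, so there is one child; afterwards only isolated vertices remain. The tree is thus a path
  ending in a star, and the word lists it from the root.\<close>

lemma search_tree_imp_split_tree:
  assumes "search_tree G t" "G = complete_split_graph P Q" "P \<inter> Q = {}" "P \<noteq> {}" "finite (P \<union> Q)"
  shows "\<exists>w. distinct w \<and> set w = P \<union> Q \<and> t = split_tree P w"
  using assms
proof (induction arbitrary: P Q rule: search_tree.induct)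
  case (1 r G f ts)
  note IH0 = "1.IH" and prems = "1.prems" and ts_eq = "1.hyps"(2)
  note G = prems(1)
  have r: "r \<in> P \<union> Q" using "1.hyps"(1) prems by auto
  have disj: "(P - {r}) \<inter> (Q - {r}) = {}" using prems by auto
  have fin: "finite (P - {r} \<union> (Q - {r}))" using prems by auto
  have IH: "search_tree (induced G C) (f C)"
    "\<And>P Q. induced G C = complete_split_graph P Q \<Longrightarrow> P \<inter> Q = {} \<Longrightarrow> P \<noteq> {} \<Longrightarrow>
      finite (P \<union> Q) \<Longrightarrow> \<exists>w. distinct w \<and> set w = P \<union> Q \<and> f C = split_tree P w"
    if "C \<in> components (delete_vertex G r)" for C
    using IH0 that by blast+
  show ?case
  proof (cases "P \<subseteq> {r}")
    case True
    then have P: "P = {r}" using prems by auto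
    then have Q: "r \<notin> Q" using prems by auto
    have comp: "components (delete_vertex G r) = (\<lambda>z. {z}) ` Q"
      using P Q by (simp add: G delete_vertex_complete_split_graph components_edgeless)
    have "f {z} = Node z {||}" if "z \<in> Q" for z
    proof -
      have "search_tree (induced G {z}) (f {z})" using IH(1)[of "{z}"] that unfolding comp by blast
      then show ?thesis
        using induced_vertex[OF that prems(2)] by (simp add: G search_tree_single_vertex)
    qed
    then have ts: "fset ts = (\<lambda>z. Node z {||}) ` Q" using ts_eq comp by (auto simp: image_image)
    obtain w where w: "set w = Q" "distinct w" using prems(4) finite_distinct_list by auto
    have "ts = (\<lambda>z. Node z {||}) |`| fset_of_list w"
      by (rule fset_inject[THEN iffD1]) (simp add: ts w fset_of_list.rep_eq)
    then show ?thesis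
      using w P Q by (intro exI[of _ "r # w"]) (simp add: split_tree.simps(2))
  next
    case False
    then have ne: "P - {r} \<noteq> {}" by auto
    have comp: "components (delete_vertex G r) = {P - {r} \<union> (Q - {r})}"
      using components_complete_split_graph[OF disj ne]
      by (simp add: G delete_vertex_complete_split_graph)
    then obtain w where w: "distinct w" "set w = P - {r} \<union> (Q - {r})"
        "f (P - {r} \<union> (Q - {r})) = split_tree (P - {r}) w"
      using IH(2)[of "P - {r} \<union> (Q - {r})" "P - {r}" "Q - {r}"] disj ne fin
        induced_minus_vertex[OF prems(2)] by (auto simp: G)
    have "ts = {|split_tree (P - {r}) w|}"
      by (rule fset_inject[THEN iffD1]) (simp add: ts_eq comp w)
    then show ?thesis
      using w False r by (intro exI[of _ "r # w"]) (auto simp: split_tree.simps(2))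
  qed
qed

lemma search_tree_split_tree:
  assumes "P \<inter> Q = {}" "P \<noteq> {}" "distinct w" "set w = P \<union> Q"
  shows "search_tree (complete_split_graph P Q) (split_tree P w)"
  using assms
proof (induction w arbitrary: P Q)
  case (Cons r w)
  have r: "r \<in> P \<union> Q" using Cons.prems by auto
  have disj: "(P - {r}) \<inter> (Q - {r}) = {}" using Cons.prems by auto
  have w: "distinct w" "set w = P - {r} \<union> (Q - {r})" using Cons.prems by auto
  show ?case
  proof (cases "P \<subseteq> {r}")
    case True
    then have P: "P = {r}" using Cons.prems by auto
    then have Q: "Q = set w" using Cons.prems by auto
    have comp: "components (delete_vertex (complete_split_graph P Q) r) = (\<lambda>z. {z}) ` Q"
      using P Q Cons.prems by (simp add: delete_vertex_complete_split_graph components_edgeless)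
    have "search_tree (complete_split_graph P Q)
        (Node r ((\<lambda>z. Node z {||}) |`| fset_of_list w))"
      by (rule search_tree.intros[of _ _ "\<lambda>C. Node (the_elem C) {||}"])
        (use r Cons.prems(1) Q in \<open>auto simp: comp[unfolded Q] induced_vertex search_tree_single_vertex
          fset_of_list.rep_eq image_image\<close>)
    then show ?thesis using True by (simp add: split_tree.simps(2))
  next
    case False
    then have ne: "P - {r} \<noteq> {}" by auto
    have comp: "components (delete_vertex (complete_split_graph P Q) r) = {P - {r} \<union> (Q - {r})}"
      using components_complete_split_graph[OF disj ne]
      by (simp add: delete_vertex_complete_split_graph)
    have "search_tree (complete_split_graph P Q) (Node r {|split_tree (P - {r}) w|})"
      by (rule search_tree.intros[of _ _ "\<lambda>_. split_tree (P - {r}) w"])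
        (use r Cons.IH[OF disj ne w] induced_minus_vertex[OF Cons.prems(1), of r] in \<open>simp_all add: comp\<close>)
    then show ?thesis using False by (simp add: split_tree.simps(2))
  qed
qed simp

lemma adjacency_rotation_graph:
  "(t, t') \<in> adjacency (rotation_graph G) \<longleftrightarrow> search_tree G t \<and> search_tree G t' \<and> rotation t t'"
  unfolding adjacency_def rotation_graph_def
  by (auto simp: doubleton_eq_iff rotation_sym)

lemma adjacency_sym: "(u, v) \<in> adjacency G \<longleftrightarrow> (v, u) \<in> adjacency G"
  unfolding adjacency_def by (simp add: insert_commute)

section \<open>Inversions and the upper bounds\<close>

text \<open>The order of positions as a relation, which makes \<open>before w - before v\<close> the
  set of inversions.\<close>

primrec before :: "'a list \<Rightarrow> ('a \<times> 'a) set" where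
  "before [] = {}"
| "before (x # w) = {x} \<times> set w \<union> before w"

lemma before_append: "before (u @ v) = before u \<union> before v \<union> set u \<times> set v"
  by (induction u) auto

lemma before_subset: "before w \<subseteq> set w \<times> set w"
  by (induction w) auto

lemma finite_before [simp]: "finite (before w)"
  by (induction w) auto

lemma before_antisym: "distinct w \<Longrightarrow> (a, b) \<in> before w \<Longrightarrow> (b, a) \<notin> before w"
  by (induction w) (use before_subset in fastforce)+

lemma before_irrefl: "distinct w \<Longrightarrow> (a, a) \<notin> before w"
  using before_antisym by metis

lemma before_total: "a \<in> set w \<Longrightarrow> b \<in> set w \<Longrightarrow> a \<noteq> b \<Longrightarrow> (a, b) \<in> before w \<or> (b, a) \<in> before w"
  by (induction w) auto

lemma before_trans: "distinct w \<Longrightarrow> (a, b) \<in> before w \<Longrightarrow> (b, c) \<in> before w \<Longrightarrow> (a, c) \<in> before w"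
  by (induction w) (use before_subset in fastforce)+

lemma before_iff:
  "distinct w \<Longrightarrow> a \<in> set w \<Longrightarrow> b \<in> set w \<Longrightarrow> (a, b) \<in> before w \<longleftrightarrow> a \<noteq> b \<and> (b, a) \<notin> before w"
  using before_total before_antisym before_irrefl by metis

lemma before_rev: "before (rev w) = (before w)\<inverse>"
  by (induction w) (auto simp: before_append)

lemma card_before: "distinct w \<Longrightarrow> card (before w) = length w choose 2"
proof (induction w)
  case (Cons x w)
  have "({x} \<times> set w) \<inter> before w = {}" using before_subset[of w] Cons by auto
  then have "card (before (x # w)) = card ({x} \<times> set w) + card (before w)"
    by (simp add: card_Un_disjoint)
  then show ?case using Cons distinct_card[of w] by (simp add: card_cartesian_product numeral_2_eq_2)
qed simp

lemma before_filter: "before (filter R w) = before w \<inter> {x. R x} \<times> {x. R x}"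
  by (induction w) auto

lemma before_swap:
  "before (u @ y # x # c) = before (u @ x # y # c) - {(x, y)} \<union> {(y, x)}"
  if "distinct (u @ x # y # c)"
  using that before_subset[of u] before_subset[of c] by (auto simp: before_append)

lemma before_subset_imp_eq:
  "distinct w \<Longrightarrow> distinct v \<Longrightarrow> set w = set v \<Longrightarrow> before w \<subseteq> before v \<Longrightarrow> w = v"
proof (induction w arbitrary: v)
  case (Cons x w)
  obtain y v' where v: "v = y # v'" using Cons.prems by (cases v) auto
  have "x = y"
  proof (rule ccontr)
    assume "x \<noteq> y"
    then have "y \<in> set w" "x \<in> set v'" using Cons.prems(3) v by auto
    then have "(x, y) \<in> before v" "(y, x) \<in> before v" using Cons.prems(4) v by auto
    then show False using before_antisym Cons.prems(2) by metis
  qed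
  moreover have "before w \<subseteq> before v'"
    using Cons.prems before_subset[of w] v calculation by auto
  moreover have "set w = set v'"
    using Cons.prems v calculation(1) insert_ident[of x "set w" "set v'"] by simp
  ultimately show ?case using Cons.IH[of v'] Cons.prems v by simp
qed simp

text \<open>If all neighbours in \<open>w\<close> were ordered as in \<open>v\<close>, transitivity
  would extend this to all pairs and force \<open>w = v\<close>.\<close>

lemma adjacent_inversion:
  assumes "distinct w" "distinct v" "set w = set v" "w \<noteq> v"
  shows "\<exists>u x y c. w = u @ x # y # c \<and> (y, x) \<in> before v"
proof (rule ccontr)
  assume no: "\<not> ?thesis"
  have "\<forall>i. Suc i < length w \<longrightarrow> (w ! i, w ! Suc i) \<in> before v"
  proof (intro allI impI)
    fix i assume i: "Suc i < length w"
    have "w = take i w @ w ! i # w ! Suc i # drop (Suc (Suc i)) w"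
      using i by (metis Cons_nth_drop_Suc Suc_lessD append_take_drop_id)
    then have "(w ! Suc i, w ! i) \<notin> before v" using no by blast
    moreover have "w ! i \<noteq> w ! Suc i" using assms(1) i by (simp add: nth_eq_iff_index_eq)
    moreover have "w ! i \<in> set v" "w ! Suc i \<in> set v" using i assms(3) nth_mem Suc_lessD by metis+
    ultimately show "(w ! i, w ! Suc i) \<in> before v" using before_total by metis
  qed
  moreover have "transp (\<lambda>x y. (x, y) \<in> before v)"
    using before_trans[OF assms(2)] by (auto intro: transpI)
  ultimately have "sorted_wrt (\<lambda>x y. (x, y) \<in> before v) w"
    by (simp add: sorted_wrt_iff_nth_Suc_transp)
  then have "before w \<subseteq> before v" by (induction w) auto
  then show False using before_subset_imp_eq assms by metis
qed

section \<open>Walks of bounded length and the two routes\<close>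

text \<open>An upper bound instead of an exact length, since a swap of two leaves costs no
  rotation.\<close>

definition reachable_in :: "'b sgraph \<Rightarrow> nat \<Rightarrow> 'b \<Rightarrow> 'b \<Rightarrow> bool" where
  "reachable_in G n u v \<longleftrightarrow> (\<exists>k\<le>n. (u, v) \<in> adjacency G ^^ k)"

lemma reachable_in_refl: "reachable_in G n u u"
  unfolding reachable_in_def by (intro exI[of _ 0]) simp

lemma reachable_in_edge: "(u, v) \<in> adjacency G \<Longrightarrow> reachable_in G 1 u v"
  unfolding reachable_in_def by (intro exI[of _ 1]) simp

lemma reachable_in_mono: "reachable_in G m u v \<Longrightarrow> m \<le> n \<Longrightarrow> reachable_in G n u v"
  unfolding reachable_in_def using le_trans by blast

lemma reachable_in_trans: "reachable_in G m u v \<Longrightarrow> reachable_in G n v w \<Longrightarrow> reachable_in G (m + n) u w"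
  unfolding reachable_in_def using relpow_trans[of u v _ "adjacency G" w] add_mono by meson

lemma reachable_in_sym: "reachable_in G n u v \<Longrightarrow> reachable_in G n v u"
proof -
  have "(u, v) \<in> adjacency G ^^ k \<Longrightarrow> (v, u) \<in> adjacency G ^^ k" for k
  proof (induction k arbitrary: v)
    case (Suc k)
    then show ?case using relpow_Suc_I2 adjacency_sym by (metis relpow_Suc_E)
  qed simp
  then show "reachable_in G n u v \<Longrightarrow> reachable_in G n v u"
    unfolding reachable_in_def by blast
qed

lemma graph_dist_le: "reachable_in G n u v \<Longrightarrow> graph_dist G u v \<le> enat n"
  unfolding reachable_in_def graph_dist_def
  by (auto intro!: INF_lower2[of _ "{n. (u, v) \<in> adjacency G ^^ n}"])

lemma graph_dist_ge:
  "(\<And>k. (u, v) \<in> adjacency G ^^ k \<Longrightarrow> n \<le> k) \<Longrightarrow> enat n \<le> graph_dist G u v"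
  unfolding graph_dist_def by (auto intro!: INF_greatest)

text \<open>Bubble sort: swapping a neighbouring inversion removes this inversion and no other, at
  the price of at most one rotation.\<close>

lemma reachable_in_inversions:
  assumes "P \<inter> Q = {}" "P \<noteq> {}" "distinct w" "distinct v" "set w = P \<union> Q" "set v = P \<union> Q"
  shows "reachable_in (rotation_graph (complete_split_graph P Q)) (card (before w - before v))
    (split_tree P w) (split_tree P v)"
  using assms(3,5)
proof (induction "card (before w - before v)" arbitrary: w rule: less_induct)
  case less
  let ?G = "rotation_graph (complete_split_graph P Q)"
  show ?case
  proof (cases "w = v")
    case True
    then show ?thesis by (simp add: reachable_in_refl)
  next
    case False
    then obtain u x y c where w: "w = u @ x # y # c" and yx: "(y, x) \<in> before v"
      using adjacent_inversion[of w v] less.prems assms by auto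
    let ?w = "u @ y # x # c"
    have d: "distinct ?w" "set ?w = P \<union> Q" using less.prems w by auto
    have xy: "(x, y) \<in> before w" "(x, y) \<notin> before v"
      using w yx before_antisym[OF assms(4)] by (auto simp: before_append)
    have b: "before ?w = before w - {(x, y)} \<union> {(y, x)}"
      using before_swap[of u x y c] less.prems w by simp
    then have "before ?w - before v = before w - before v - {(x, y)}" using yx by auto
    then have card: "card (before w - before v) = Suc (card (before ?w - before v))"
      using xy card_Suc_Diff1[of "before w - before v" "(x, y)"] by simp
    have IH: "reachable_in ?G (card (before ?w - before v)) (split_tree P ?w) (split_tree P v)"
      using less.hyps[of ?w] card d by simp
    have "reachable_in ?G 1 (split_tree P w) (split_tree P ?w)"
    proof -
      have "adjacent_swap w ?w" unfolding adjacent_swap_def w by blast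
      then have "split_tree P w = split_tree P ?w \<or> rotation (split_tree P w) (split_tree P ?w)"
        using swap_imp_rotation[of P w ?w] assms less.prems by auto
      then show ?thesis
        using reachable_in_refl reachable_in_edge adjacency_rotation_graph search_tree_split_tree assms(1,2)
          less.prems d by metis
    qed
    from reachable_in_trans[OF this IH] show ?thesis using card by simp
  qed
qed

lemma card_before_Int:
  assumes "distinct w" "A \<subseteq> set w"
  shows "card (before w \<inter> A \<times> A) = card A choose 2"
proof -
  have "set (filter (\<lambda>x. x \<in> A) w) = A" using assms by auto
  then have "length (filter (\<lambda>x. x \<in> A) w) = card A"
    using distinct_card[of "filter (\<lambda>x. x \<in> A) w"] assms by simp
  then show ?thesis
    using card_before[of "filter (\<lambda>x. x \<in> A) w"] assms(1) by (simp add: before_filter)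
qed

lemma reachable_in_detour:
  assumes "P \<inter> Q = {}" "P \<noteq> {}" "distinct w" "distinct v" "set w = P \<union> Q" "set v = P \<union> Q"
  shows "reachable_in (rotation_graph (complete_split_graph P Q))
    (card (before w \<inter> Q \<times> P) + card (before v \<inter> Q \<times> P) + (card P choose 2))
    (split_tree P w) (split_tree P v)"
proof -
  let ?W = "reachable_in (rotation_graph (complete_split_graph P Q))"
  let ?p = "filter (\<lambda>x. x \<in> P)" and ?q = "filter (\<lambda>x. x \<in> Q)"
  \<comment> \<open>Moving \<open>P\<close> to the front with both internal orders kept reverses
    only pairs in \<open>Q \<times> P\<close>.\<close>
  have down: "?W (card (before w \<inter> Q \<times> P)) (split_tree P w) (split_tree P (?p w @ ?q w))"
    if "distinct w" "set w = P \<union> Q" for w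
  proof -
    have "before w - before (?p w @ ?q w) \<subseteq> before w \<inter> Q \<times> P"
      using before_subset[of w] that by (auto simp: before_append before_filter)
    then have "card (before w - before (?p w @ ?q w)) \<le> card (before w \<inter> Q \<times> P)"
      by (intro card_mono) auto
    moreover have "distinct (?p w @ ?q w)" "set (?p w @ ?q w) = P \<union> Q" using that assms(1) by auto
    ultimately show ?thesis
      using that assms(1,2) by (intro reachable_in_mono[OF reachable_in_inversions])
  qed
  \<comment> \<open>Now all of \<open>Q\<close> are leaves and can be rearranged for free.\<close>
  have "tail_eq P (?p w @ ?q w) (?p w @ ?q v)"
    using assms by (intro tail_eq_append) auto
  then have eq: "split_tree P (?p w @ ?q w) = split_tree P (?p w @ ?q v)"
    using assms by (intro split_tree_tail_eq) auto
  \<comment> \<open>Only pairs inside \<open>P\<close> can still be in the wrong order.\<close>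
  have "before (?p w @ ?q v) - before (?p v @ ?q v) \<subseteq> before w \<inter> P \<times> P"
    using assms by (auto simp: before_append before_filter)
  then have "card (before (?p w @ ?q v) - before (?p v @ ?q v)) \<le> card (before w \<inter> P \<times> P)"
    by (intro card_mono) auto
  also have "\<dots> = card P choose 2"
    using assms by (intro card_before_Int) auto
  finally have "card (before (?p w @ ?q v) - before (?p v @ ?q v)) \<le> card P choose 2" .
  moreover have "distinct (?p w @ ?q v)" "set (?p w @ ?q v) = P \<union> Q"
    "distinct (?p v @ ?q v)" "set (?p v @ ?q v) = P \<union> Q" using assms by auto
  ultimately have "?W (card P choose 2) (split_tree P (?p w @ ?q w)) (split_tree P (?p v @ ?q v))"
    unfolding eq using assms(1,2) by (intro reachable_in_mono[OF reachable_in_inversions])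
  then have "?W (card (before w \<inter> Q \<times> P) + (card P choose 2) + card (before v \<inter> Q \<times> P))
      (split_tree P w) (split_tree P v)"
    using reachable_in_trans reachable_in_sym down assms by meson
  then show ?thesis by (simp add: ac_simps)
qed

text \<open>Each of the \<open>card P * card Q\<close> mixed pairs counts at most twice: with the
  vertex of \<open>Q\<close> first in both words it is no inversion but adds one to each detour
  term, with it first in just one word it is one inversion and adds one, and otherwise it adds
  nothing.\<close>

lemma inversions_plus_detour:
  assumes "finite P" "finite Q" "P \<inter> Q = {}" "distinct w" "distinct v" "set w = P \<union> Q" "set v = P \<union> Q"
  shows "card (before w - before v) + card (before w \<inter> Q \<times> P) + card (before v \<inter> Q \<times> P)
    \<le> 2 * (card P * card Q) + (card Q choose 2) + (card P choose 2)"
proof -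
  let ?A = "before w \<inter> Q \<times> P" and ?B = "before v \<inter> Q \<times> P"
  have sub: "before w - before v \<subseteq>
      before w \<inter> P \<times> P \<union> before w \<inter> Q \<times> Q \<union> (?A - ?B) \<union> (?B - ?A)\<inverse>"
  proof (rule subrelI)
    fix a b assume ab: "(a, b) \<in> before w - before v"
    then have "a \<in> set w" "b \<in> set w" "a \<noteq> b" "(b, a) \<in> before v" "(b, a) \<notin> before w"
      using before_subset before_iff[OF assms(5)] before_antisym[OF assms(4)] assms(6,7)
        before_irrefl[OF assms(4)] by blast+
    then show "(a, b) \<in> before w \<inter> P \<times> P \<union> before w \<inter> Q \<times> Q \<union> (?A - ?B) \<union> (?B - ?A)\<inverse>"
      using ab assms(6) by auto
  qed
  have fin: "finite ?A" "finite ?B" by simp_all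
  have "card (before w - before v) \<le>
      card (before w \<inter> P \<times> P \<union> before w \<inter> Q \<times> Q \<union> (?A - ?B) \<union> (?B - ?A)\<inverse>)"
    by (rule card_mono[OF _ sub]) simp
  also have "\<dots> \<le> card (before w \<inter> P \<times> P) + card (before w \<inter> Q \<times> Q) + card (?A - ?B) + card ((?B - ?A)\<inverse>)"
    by (meson add_mono card_Un_le le_trans order_refl)
  also have "\<dots> = (card P choose 2) + (card Q choose 2) + card (?A - ?B) + card (?B - ?A)"
    using card_before_Int[OF assms(4), of P] card_before_Int[OF assms(4), of Q] assms(6) by simp
  finally have 1: "card (before w - before v) \<le> \<dots>" .
  have "card ?A + card (?B - ?A) = card (?A \<union> ?B)" "card ?B + card (?A - ?B) = card (?A \<union> ?B)"
    using card_Un_disjoint[of ?A "?B - ?A"] card_Un_disjoint[of ?B "?A - ?B"] fin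
    by (auto simp: Un_commute)
  moreover have "card (?A \<union> ?B) \<le> card (Q \<times> P)" using assms by (intro card_mono) auto
  ultimately show ?thesis using 1 by (simp add: card_cartesian_product mult.commute)
qed

section \<open>The lower bound\<close>

text \<open>These are the vertices behind the last element of \<open>P\<close>, the leaves whose
  order the tree forgets.\<close>

definition trailing :: "'a set \<Rightarrow> 'a list \<Rightarrow> 'a set" where
  "trailing P w = {z \<in> set w. \<forall>x\<in>P. (x, z) \<in> before w}"

definition target :: "'a set \<Rightarrow> 'a set \<Rightarrow> ('a \<times> 'a) set \<Rightarrow> ('a \<times> 'a) set \<Rightarrow> 'a set \<Rightarrow> ('a \<times> 'a) set" where
  "target P Q R R' S = S \<times> P \<union> P \<times> (Q - S) \<union> R \<union> (R' - S \<times> S)"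

text \<open>The pairs counted by \<^term>\<open>target\<close> are those that must have been created if exactly the
  elements of \<open>S\<close> have been leaves; the term \<open>card P * card S\<close> pays for their descent.\<close>

definition potential ::
    "'a set \<Rightarrow> 'a set \<Rightarrow> ('a \<times> 'a) set \<Rightarrow> ('a \<times> 'a) set \<Rightarrow> 'a list \<Rightarrow> 'a set \<Rightarrow> nat" where
  "potential P Q R R' w S = card (before w \<inter> target P Q R R' S) + card P * card S"

text \<open>If \<open>S\<close> still covers the leaves, one swap creates one pair. Otherwise the
  moved vertex joins \<open>S\<close>, and the pairs that stop counting pay for all but one of the
  \<open>card P\<close> units added.\<close>

lemma potential_step:
  assumes disj: "P \<inter> Q = {}" and fin: "finite P" "finite Q" and R: "R \<subseteq> P \<times> P" "R' \<subseteq> Q \<times> Q"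
    and w: "distinct w" "set w = P \<union> Q" and swap: "adjacent_swap w w'"
    and S: "trailing P w \<subseteq> S" "S \<subseteq> Q"
  shows "\<exists>S'. trailing P w' \<subseteq> S' \<and> S' \<subseteq> Q \<and> potential P Q R R' w' S' \<le> potential P Q R R' w S + 1"
proof -
  obtain u x y c where wu: "w = u @ x # y # c" "w' = u @ y # x # c"
    using swap unfolding adjacent_swap_def by blast
  have w': "distinct w'" "set w' = P \<union> Q" using w wu by auto
  have b: "before w' = before w - {(x, y)} \<union> {(y, x)}" using before_swap w wu by metis
  let ?T = "target P Q R R'"
  show ?thesis
  proof (cases "trailing P w' \<subseteq> S")
    case True
    have "before w' \<inter> ?T S \<subseteq> insert (y, x) (before w \<inter> ?T S)" using b by auto
    then have "card (before w' \<inter> ?T S) \<le> card (insert (y, x) (before w \<inter> ?T S))"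
      by (intro card_mono) auto
    also have "\<dots> \<le> card (before w \<inter> ?T S) + 1" by (simp add: card_insert_if)
    finally have "potential P Q R R' w' S \<le> potential P Q R R' w S + 1"
      unfolding potential_def by simp
    then show ?thesis using True S by blast
  next
    case False
    \<comment> \<open>\<open>(y, x)\<close> is the only new pair, so nothing but \<open>x\<close>
      can become a leaf, namely by passing a clique vertex \<open>y\<close>.\<close>
    have trailing: "z = x \<and> y \<in> P" if "z \<in> trailing P w'" "z \<notin> S" for z
    proof -
      have "z \<notin> trailing P w" using that S by auto
      moreover have z: "z \<in> set w" "\<forall>a\<in>P. (a, z) \<in> before w'"
        using that(1) w(2) w'(2) unfolding trailing_def by auto
      ultimately obtain a where "a \<in> P" "(a, z) \<notin> before w" "(a, z) \<in> before w'"
        unfolding trailing_def by auto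
      then show ?thesis using b by auto
    qed
    then have x: "x \<in> trailing P w'" "x \<notin> S" "y \<in> P" using False by auto
    have xP: "x \<notin> P" using x(1) before_irrefl[OF w'(1)] unfolding trailing_def by auto
    have xQ: "x \<in> Q" using w wu xP by auto
    \<comment> \<open>\<open>x\<close> becomes a leaf for the first time: the \<open>p - 1\<close> pairs in \<open>?E\<close> stop counting and
      \<open>p * card S\<close> grows by \<open>p\<close>.\<close>
    let ?S = "insert x S" and ?E = "(P - {y}) \<times> {x}"
    have "trailing P w' \<subseteq> ?S" using trailing by auto
    moreover have "?S \<subseteq> Q" using S xQ by auto
    moreover have "potential P Q R R' w' ?S \<le> potential P Q R R' w S + 1"
    proof -
      have E: "?E \<subseteq> before w \<inter> ?T S"
        using x xQ b unfolding trailing_def target_def by auto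
      \<comment> \<open>Nothing starts to count: \<open>(y, x)\<close> is outside the target once
        \<open>x\<close> is in the set, and the target pairs from \<open>x\<close> to
        \<open>P\<close> are absent because \<open>x\<close> is behind all of
        \<open>P\<close>.\<close>
      have "before w' \<inter> ?T ?S \<subseteq> before w \<inter> ?T S - ?E"
      proof (rule subrelI)
        fix a d assume ad: "(a, d) \<in> before w' \<inter> ?T ?S"
        have nx: "\<not> (a \<in> P \<and> d = x)" using ad R disj xP x(3) unfolding target_def by auto
        then have "(a, d) \<in> before w" using ad b x(3) by auto
        moreover have "\<not> (a = x \<and> d \<in> P)"
          using ad x(1) before_antisym[OF w'(1)] unfolding trailing_def by auto
        then have "(a, d) \<in> ?T S" using ad unfolding target_def by auto
        ultimately show "(a, d) \<in> before w \<inter> ?T S - ?E" using nx by auto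
      qed
      then have "card (before w' \<inter> ?T ?S) \<le> card (before w \<inter> ?T S - ?E)"
        by (intro card_mono) auto
      also have "\<dots> = card (before w \<inter> ?T S) - card ?E"
        using E fin by (intro card_Diff_subset) auto
      finally have "card (before w' \<inter> ?T ?S) + card ?E \<le> card (before w \<inter> ?T S)"
        using card_mono[OF _ E] by simp
      moreover have "card ?E + 1 = card P"
        using fin x(3) by (simp add: card_cartesian_product card_gt_0_iff card_Diff_singleton)
          (metis card_gt_0_iff empty_iff Suc_pred)
      moreover have "card ?S = card S + 1" using x(2) S fin finite_subset by fastforce
      ultimately show ?thesis unfolding potential_def by simp
    qed
    ultimately show ?thesis by blast
  qed
qed

text \<open>Only leaves change their order, all of them belong to \<open>S\<close>, and the target
  contains no pair of leaves inside \<open>S \<times> S\<close>.\<close>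

lemma potential_tail_eq:
  assumes disj: "P \<inter> Q = {}" and R: "R \<subseteq> P \<times> P" "R' \<subseteq> Q \<times> Q" and P: "P \<noteq> {}" "P \<subseteq> set w"
    and eq: "tail_eq P w v" and S: "trailing P w \<subseteq> S"
  shows "trailing P v \<subseteq> S \<and> potential P Q R R' v S \<le> potential P Q R R' w S"
proof -
  obtain u c c' where u: "w = u @ c" "v = u @ c'" "set c = set c'" "set c \<inter> P = {}"
    using eq by (rule tail_eqE)
  have Pu: "P \<subseteq> set u" using u P by auto
  have cS: "set c \<subseteq> S" using S Pu u unfolding trailing_def by (auto simp: before_append)
  have "trailing P v \<subseteq> trailing P w \<union> set c"
    using Pu u before_subset[of c'] unfolding trailing_def by (auto simp: before_append)
  then have "trailing P v \<subseteq> S" using S cS by auto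
  moreover have "before v \<inter> target P Q R R' S \<subseteq> before w \<inter> target P Q R R' S"
    using u cS before_subset[of c'] R disj unfolding target_def by (auto simp: before_append)
  then have "potential P Q R R' v S \<le> potential P Q R R' w S"
    unfolding potential_def by (intro add_right_mono card_mono) auto
  ultimately show ?thesis by blast
qed

text \<open>Each edge of the walk is a swap between suitable representatives, so the potential grows
  by at most one per step; exchanging representatives does not raise it.\<close>

lemma potential_walk:
  assumes disj: "P \<inter> Q = {}" and fin: "finite P" "finite Q" and R: "R \<subseteq> P \<times> P" "R' \<subseteq> Q \<times> Q"
    and P: "P \<noteq> {}" and start: "distinct w\<^sub>0" "set w\<^sub>0 = P \<union> Q" "trailing P w\<^sub>0 = {}"
    and w: "distinct w" "set w = P \<union> Q"
    and walk: "(split_tree P w\<^sub>0, split_tree P w) \<in> adjacency (rotation_graph (complete_split_graph P Q)) ^^ n"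
  shows "\<exists>S. trailing P w \<subseteq> S \<and> S \<subseteq> Q \<and> potential P Q R R' w S \<le> potential P Q R R' w\<^sub>0 {} + n"
  using w walk
proof (induction n arbitrary: w)
  case 0
  then have "tail_eq P w\<^sub>0 w" using tubes_split_tree_inj[of P w\<^sub>0 w] start P by auto
  then show ?case
    using potential_tail_eq[OF disj R P, of w\<^sub>0 w "{}"] start by auto
next
  case (Suc n)
  let ?G = "rotation_graph (complete_split_graph P Q)"
  obtain t where t: "(split_tree P w\<^sub>0, t) \<in> adjacency ?G ^^ n" "(t, split_tree P w) \<in> adjacency ?G"
    using Suc.prems(3) by auto
  then obtain w\<^sub>1 where w1: "distinct w\<^sub>1" "set w\<^sub>1 = P \<union> Q" "t = split_tree P w\<^sub>1"
    using search_tree_imp_split_tree[of _ t P Q] disj P fin adjacency_rotation_graph by blast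
  have "rotation (split_tree P w\<^sub>1) (split_tree P w)" using t(2) w1(3) adjacency_rotation_graph by blast
  then obtain v v' where v: "tail_eq P w\<^sub>1 v" "tail_eq P w v'" "adjacent_swap v v'"
    using rotation_imp_swap[of P w\<^sub>1 w] w1 Suc.prems P by auto
  \<comment> \<open>\<open>v\<close> represents the same tree as \<open>w\<^sub>1\<close>, hence the
    induction hypothesis applies to it directly.\<close>
  have v_perm: "distinct v" "set v = P \<union> Q" "split_tree P v = t"
    using tail_eq_distinct[OF v(1)] split_tree_tail_eq[OF v(1)] w1 P by auto
  then obtain S where S: "trailing P v \<subseteq> S" "S \<subseteq> Q" "potential P Q R R' v S \<le> potential P Q R R' w\<^sub>0 {} + n"
    using Suc.IH[of v] t(1) by auto
  obtain S' where S': "trailing P v' \<subseteq> S'" "S' \<subseteq> Q" "potential P Q R R' v' S' \<le> potential P Q R R' v S + 1"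
    using potential_step[OF disj fin R v_perm(1,2) v(3) S(1,2)] by blast
  have "set v' = P \<union> Q" using tail_eq_distinct[OF v(2)] Suc.prems by auto
  then have "trailing P w \<subseteq> S' \<and> potential P Q R R' w S' \<le> potential P Q R R' v' S'"
    using potential_tail_eq[OF disj R P _ tail_eq_sym[OF v(2)] S'(1)] by auto
  then show ?case using S S' by (intro exI[of _ S']) auto
qed

lemma choose_two_int: "2 * int (n choose 2) = int n * (int n - 1)"
proof (induction n)
  case (Suc n)
  have "Suc n choose 2 = n + (n choose 2)" by (simp add: numeral_2_eq_2)
  then show ?case using Suc by (simp add: algebra_simps)
qed (simp add: numeral_2_eq_2)

text \<open>The height of a vertex of \<open>Q\<close> is the number of clique vertices below it:
  \<open>length ys + length zs\<close> on \<open>us\<close> and \<open>length zs\<close> on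
  \<open>vs\<close>. Inside \<open>S\<close> a vertex contributes its height besides the term
  \<open>card P\<close>, outside \<open>S\<close> the number of clique vertices above it. The
  \<open>(a + b) choose 2\<close> pairs inside \<open>S\<close> are not counted.\<close>

lemma potential_endpoint:
  assumes disj: "P \<inter> Q = {}"
    and zs: "distinct (us @ vs)" "set (us @ vs) = Q"
    and ps: "distinct (xs @ ys @ zs)" "set (xs @ ys @ zs) = P"
    and S: "S \<subseteq> Q"
  defines "a \<equiv> card (S \<inter> set us)" and "b \<equiv> card (S \<inter> set vs)"
  shows "a * (length ys + length zs) + b * length zs + (length us - a) * length xs
      + (length vs - b) * (length xs + length ys)
      + (card P choose 2) + (card Q choose 2) + card P * (a + b)
    \<le> potential P Q (before (xs @ ys @ zs)) (before (us @ vs)) (xs @ us @ ys @ vs @ zs) S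
      + ((a + b) choose 2)"
    and "card S = a + b"
proof -
  let ?w = "xs @ us @ ys @ vs @ zs" and ?R = "before (xs @ ys @ zs)" and ?R' = "before (us @ vs)"
  define U1 U2 U3 U4 where "U1 = (S \<inter> set us) \<times> set (ys @ zs)" and "U2 = (S \<inter> set vs) \<times> set zs"
    and "U3 = set xs \<times> (set us - S)" and "U4 = set (xs @ ys) \<times> (set vs - S)"
  note U = U1_def U2_def U3_def U4_def
  have sub: "?R \<subseteq> P \<times> P" "?R' \<subseteq> Q \<times> Q"
    using before_subset[of "xs @ ys @ zs"] before_subset[of "us @ vs"] ps zs by simp_all
  have PQ: "U1 \<subseteq> Q \<times> P" "U2 \<subseteq> Q \<times> P" "U3 \<subseteq> P \<times> Q" "U4 \<subseteq> P \<times> Q"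
    using zs(2) ps(2) unfolding U by auto
  have uv: "set us \<inter> set vs = {}" using zs by auto
  have incl: "U1 \<union> U2 \<union> U3 \<union> U4 \<union> ?R \<union> (?R' - S \<times> S) \<subseteq> before ?w \<inter> target P Q ?R ?R' S"
  proof -
    have "U1 \<union> U2 \<subseteq> S \<times> P" "U3 \<union> U4 \<subseteq> P \<times> (Q - S)" using zs(2) ps(2) unfolding U by auto
    then have 1: "U1 \<union> U2 \<union> U3 \<union> U4 \<union> ?R \<union> (?R' - S \<times> S) \<subseteq> target P Q ?R ?R' S"
      unfolding target_def by blast
    have "U1 \<union> U2 \<union> U3 \<union> U4 \<union> ?R \<union> ?R' \<subseteq> before ?w"
      unfolding U by (auto simp: before_append)
    then show ?thesis using 1 by blast
  qed
  have fin: "finite U1" "finite U2" "finite U3" "finite U4" unfolding U by auto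
  have disjs: "U1 \<inter> U2 = {}" "(U1 \<union> U2) \<inter> U3 = {}" "(U1 \<union> U2 \<union> U3) \<inter> U4 = {}"
    "(U1 \<union> U2 \<union> U3 \<union> U4) \<inter> ?R = {}" "(U1 \<union> U2 \<union> U3 \<union> U4 \<union> ?R) \<inter> (?R' - S \<times> S) = {}"
  proof -
    show "U1 \<inter> U2 = {}" using uv unfolding U by auto
    show "(U1 \<union> U2) \<inter> U3 = {}" using PQ disj by blast
    have "U3 \<inter> U4 = {}" using uv unfolding U by auto
    then show "(U1 \<union> U2 \<union> U3) \<inter> U4 = {}" using PQ disj by blast
    show "(U1 \<union> U2 \<union> U3 \<union> U4) \<inter> ?R = {}" using PQ disj sub by blast
    show "(U1 \<union> U2 \<union> U3 \<union> U4 \<union> ?R) \<inter> (?R' - S \<times> S) = {}" using PQ disj sub by blast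
  qed
  have "card U1 + card U2 + card U3 + card U4 + card ?R + card (?R' - S \<times> S)
      = card (U1 \<union> U2 \<union> U3 \<union> U4 \<union> ?R \<union> (?R' - S \<times> S))"
    using disjs fin by (simp add: card_Un_disjoint)
  also have "\<dots> \<le> card (before ?w \<inter> target P Q ?R ?R' S)"
    using incl by (intro card_mono) auto
  finally have main: "card U1 + card U2 + card U3 + card U4 + card ?R + card (?R' - S \<times> S)
      \<le> card (before ?w \<inter> target P Q ?R ?R' S)" .
  have "S = (S \<inter> set us) \<union> (S \<inter> set vs)" using S zs(2) by auto
  then show cS: "card S = a + b"
    using card_Un_disjoint[of "S \<inter> set us" "S \<inter> set vs"] uv unfolding a_def b_def by auto
  have xy: "set xs \<inter> set ys = {}" using ps(1) by auto
  have cU: "card U1 = a * (length ys + length zs)" "card U2 = b * length zs"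
    "card U3 = (length us - a) * length xs" "card U4 = (length vs - b) * (length xs + length ys)"
    using xy ps(1) zs(1) distinct_card[of "ys @ zs"] distinct_card[of zs] distinct_card[of xs]
      distinct_card[of "xs @ ys"] distinct_card[of us] distinct_card[of vs]
    unfolding U a_def b_def
    by (simp_all add: card_cartesian_product card_Diff_subset_Int Int_commute)
  have cR: "card ?R = card P choose 2"
    using card_before[OF ps(1)] distinct_card[OF ps(1)] ps(2) by simp
  have "card ?R' = card (?R' - S \<times> S) + card (?R' \<inter> S \<times> S)"
    using card_Diff_subset_Int[of ?R' "S \<times> S"] card_mono[of ?R' "?R' \<inter> S \<times> S"] by simp
  moreover have "card ?R' = card Q choose 2"
    using card_before[OF zs(1)] distinct_card[OF zs(1)] zs(2) by simp
  moreover have "card (?R' \<inter> S \<times> S) = (a + b) choose 2"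
    using card_before_Int[OF zs(1), of S] S zs(2) cS by simp
  ultimately have cR': "card Q choose 2 = card (?R' - S \<times> S) + ((a + b) choose 2)" by simp
  show "a * (length ys + length zs) + b * length zs + (length us - a) * length xs
      + (length vs - b) * (length xs + length ys)
      + (card P choose 2) + (card Q choose 2) + card P * (a + b)
    \<le> potential P Q ?R ?R' ?w S + ((a + b) choose 2)"
    using main cU cR cR' cS unfolding potential_def by simp
qed

text \<open>A walk may use any \<open>S\<close>, but the estimate sees only the numbers
  \<open>a\<close> and \<open>b\<close> of its elements in the upper and the lower block of
  \<open>Q\<close>. The sizes \<open>x\<close>, \<open>e\<close>, \<open>d\<close>, \<open>r\<close>
  describe the final word and are left to the caller.\<close>

lemma diameter_ge:
  assumes disj: "P \<inter> Q = {}" and fin: "finite P" "finite Q" and P: "P \<noteq> {}"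
    and lens: "x + e + d = card P" "r \<le> card Q"
    and bound: "\<And>a b. a \<le> r \<Longrightarrow> b \<le> card Q - r \<Longrightarrow>
      N + ((a + b) choose 2) \<le> a * (e + d) + b * d + (r - a) * x + (card Q - r - b) * (x + e)
        + (card P choose 2) + (card Q choose 2) + card P * (a + b)"
  shows "enat N \<le> associahedron_diameter (complete_split_graph P Q)"
proof -
  let ?G = "rotation_graph (complete_split_graph P Q)"
  obtain ps where ps: "set ps = P" "distinct ps" using finite_distinct_list fin by auto
  obtain qs where qs: "set qs = Q" "distinct qs" using finite_distinct_list fin by auto
  have len: "length ps = card P" "length qs = card Q" using ps qs distinct_card by metis+
  obtain xs ys zs where xyz: "rev ps = xs @ ys @ zs" "length xs = x" "length ys = e" "length zs = d"
  proof
    show "rev ps = take x (rev ps) @ take e (drop x (rev ps)) @ drop e (drop x (rev ps))"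
      by (simp only: append_take_drop_id)
  qed (use lens len in auto)
  obtain us vs where uv: "qs = us @ vs" "length us = r" "length vs = card Q - r"
  proof
    show "qs = take r qs @ drop r qs" by simp
  qed (use lens len in auto)
  define w\<^sub>0 w\<^sub>1 where "w\<^sub>0 = rev qs @ ps" and "w\<^sub>1 = xs @ us @ ys @ vs @ zs"
  have pset: "distinct (xs @ ys @ zs)" "set (xs @ ys @ zs) = P"
    using ps xyz(1) by (metis distinct_rev, metis set_rev)
  have qset: "distinct (us @ vs)" "set (us @ vs) = Q" using qs uv by auto
  have w0: "distinct w\<^sub>0" "set w\<^sub>0 = P \<union> Q" using ps qs disj unfolding w\<^sub>0_def by auto
  have w1: "distinct w\<^sub>1" "set w\<^sub>1 = P \<union> Q" using pset qset disj unfolding w\<^sub>1_def by auto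
  let ?R = "before (xs @ ys @ zs)" and ?R' = "before (us @ vs)"
  have R: "?R \<subseteq> P \<times> P" "?R' \<subseteq> Q \<times> Q"
    using before_subset[of "xs @ ys @ zs"] before_subset[of "us @ vs"] pset qset by simp_all
  have b0: "before w\<^sub>0 = ?R'\<inverse> \<union> ?R\<inverse> \<union> Q \<times> P"
    using before_rev[of qs] before_rev[of ps] ps qs uv xyz(1)
    unfolding w\<^sub>0_def before_append[of "rev qs" ps] by auto
  have start: "trailing P w\<^sub>0 = {}"
  proof -
    have "z \<notin> trailing P w\<^sub>0" for z
    proof
      assume z: "z \<in> trailing P w\<^sub>0"
      then have "\<forall>x\<in>P. (x, z) \<in> before w\<^sub>0" unfolding trailing_def by simp
      moreover obtain x where "x \<in> P" using P by auto
      moreover have "z \<notin> P" using calculation(1) before_irrefl[OF w0(1)] by auto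
      moreover have "z \<in> P \<union> Q" using z w0(2) unfolding trailing_def by auto
      ultimately show False using b0 R disj by blast
    qed
    then show ?thesis by auto
  qed
  \<comment> \<open>The start has both orders reversed and no clique vertex above \<open>Q\<close>,
    so none of the pairs to be created is present yet.\<close>
  have "before w\<^sub>0 \<inter> target P Q ?R ?R' {} = {}"
  proof -
    have "?R\<inverse> \<inter> ?R = {}" "?R'\<inverse> \<inter> ?R' = {}"
      using before_antisym[OF pset(1)] before_antisym[OF qset(1)] by auto
    then show ?thesis unfolding b0 target_def using R disj by blast
  qed
  then have pot0: "potential P Q ?R ?R' w\<^sub>0 {} = 0" unfolding potential_def by simp
  have "N \<le> n" if walk: "(split_tree P w\<^sub>0, split_tree P w\<^sub>1) \<in> adjacency ?G ^^ n" for n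
  proof -
    obtain S where S: "S \<subseteq> Q" "potential P Q ?R ?R' w\<^sub>1 S \<le> n"
      using potential_walk[OF disj fin R P w0 start w1 walk] pot0 by auto
    define a b where "a = card (S \<inter> set us)" and "b = card (S \<inter> set vs)"
    have ab: "a \<le> r" "b \<le> card Q - r"
      using card_mono[of "set us" "S \<inter> set us"] card_length[of us] uv(2)
        card_mono[of "set vs" "S \<inter> set vs"] card_length[of vs] uv(3)
      unfolding a_def b_def by simp_all
    show ?thesis
      using bound[OF ab] potential_endpoint(1)[OF disj qset pset S(1)] S(2) uv xyz
      unfolding a_def b_def w\<^sub>1_def by simp
  qed
  then have "enat N \<le> graph_dist ?G (split_tree P w\<^sub>0) (split_tree P w\<^sub>1)" by (rule graph_dist_ge)
  also have "\<dots> \<le> associahedron_diameter (complete_split_graph P Q)"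
  proof -
    have "split_tree P w\<^sub>0 \<in> verts ?G" "split_tree P w\<^sub>1 \<in> verts ?G"
      using search_tree_split_tree[OF disj P] w0 w1 unfolding rotation_graph_def by auto
    then show ?thesis
      unfolding associahedron_diameter_def graph_diameter_def by (meson SUP_upper2 order_refl)
  qed
  finally show ?thesis .
qed

lemma diameter_le:
  assumes disj: "P \<inter> Q = {}" and fin: "finite P" "finite Q" and P: "P \<noteq> {}"
  shows "associahedron_diameter (complete_split_graph P Q)
      \<le> enat (2 * card P * card Q + (card P choose 2))"
    and "associahedron_diameter (complete_split_graph P Q)
      \<le> enat (card P * card Q + (card Q choose 2) div 2 + (card P choose 2))"
proof -
  let ?G = "rotation_graph (complete_split_graph P Q)"
  have both: "graph_dist ?G t t' \<le> enat (2 * card P * card Q + (card P choose 2)) \<and>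
      graph_dist ?G t t' \<le> enat (card P * card Q + (card Q choose 2) div 2 + (card P choose 2))"
    if tt: "t \<in> verts ?G" "t' \<in> verts ?G" for t t'
  proof -
    have "\<exists>w. distinct w \<and> set w = P \<union> Q \<and> t = split_tree P w" if "t \<in> verts ?G" for t
      using that search_tree_imp_split_tree[OF _ refl disj P] fin unfolding rotation_graph_def by auto
    then obtain w v where w: "distinct w" "set w = P \<union> Q" "t = split_tree P w"
      and v: "distinct v" "set v = P \<union> Q" "t' = split_tree P v"
      using tt by metis
    let ?I = "card (before w - before v)"
    let ?D = "card (before w \<inter> Q \<times> P) + card (before v \<inter> Q \<times> P) + (card P choose 2)"
    have I: "graph_dist ?G t t' \<le> enat ?I"
      using graph_dist_le[OF reachable_in_inversions[OF disj P w(1) v(1) w(2) v(2)]] w v by simp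
    have D: "graph_dist ?G t t' \<le> enat ?D"
      using graph_dist_le[OF reachable_in_detour[OF disj P w(1) v(1) w(2) v(2)]] w v by simp
    have "card (before u \<inter> Q \<times> P) \<le> card P * card Q" for u :: "'a list"
      using card_mono[of "Q \<times> P" "before u \<inter> Q \<times> P"] fin
      by (simp add: card_cartesian_product mult.commute)
    from this[of w] this[of v] have "?D \<le> 2 * card P * card Q + (card P choose 2)" by simp
    then have 1: "graph_dist ?G t t' \<le> enat (2 * card P * card Q + (card P choose 2))"
      using D order_trans enat_ord_simps(1) by blast
    have sum: "?I + ?D \<le> 2 * (card P * card Q) + (card Q choose 2) + 2 * (card P choose 2)"
      using inversions_plus_detour[OF fin disj w(1) v(1) w(2) v(2)] by simp
    \<comment> \<open>The two routes cannot both be longer than half their total, and rounding down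
      is harmless for integer lengths.\<close>
    then have "?I \<le> card P * card Q + (card Q choose 2) div 2 + (card P choose 2) \<or>
        ?D \<le> card P * card Q + (card Q choose 2) div 2 + (card P choose 2)"
      by linarith
    then have "graph_dist ?G t t' \<le> enat (card P * card Q + (card Q choose 2) div 2 + (card P choose 2))"
      using I D order_trans enat_ord_simps(1) by blast
    then show ?thesis using 1 by simp
  qed
  show "associahedron_diameter (complete_split_graph P Q)
      \<le> enat (2 * card P * card Q + (card P choose 2))"
    "associahedron_diameter (complete_split_graph P Q)
      \<le> enat (card P * card Q + (card Q choose 2) div 2 + (card P choose 2))"
    unfolding associahedron_diameter_def graph_diameter_def using both by (auto intro!: SUP_least)
qed

text \<open>Here \<open>\<epsilon>\<close> is the parity of \<open>q choose 2\<close>, \<open>r\<close> elements of \<open>Q\<close> have height \<open>d + 1\<close> and the other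
  \<open>q - r\<close> have height \<open>d\<close>, and \<open>S\<close> contains \<open>a\<close> of the former and \<open>b\<close> of the latter.\<close>

lemma balanced_heights_bound:
  fixes a b q d r \<epsilon> :: int
  assumes a: "0 \<le> a" "a \<le> r" and b: "0 \<le> b" "b \<le> q - r" and r: "r < q" and d: "0 \<le> d"
    and eps: "0 \<le> \<epsilon>" "\<epsilon> \<le> 1" and q: "q * (q - 1) = 4 * q * d + 4 * r + 2 * \<epsilon>"
  shows "(a + b) * (a + b - 1) \<le> 4 * d * (a + b) + 4 * a + 2 * \<epsilon>"
proof -
  let ?s = "a + b"
  have "q \<ge> 1" using a b r by linarith
  \<comment> \<open>The general argument needs \<open>4 \<le> q\<close>. For \<open>q = 2\<close>
    and \<open>q = 3\<close> the equation for \<open>q\<close> determines \<open>d\<close>,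
    \<open>r\<close> and \<open>\<epsilon>\<close>.\<close>
  then consider "q = 1" | "q = 2" | "q = 3" | "q \<ge> 4" by linarith
  then show ?thesis
  proof cases
    case 1
    then have "r = 0" "a = 0" "b = 0 \<or> b = 1" using a b r by linarith+
    then show ?thesis using eps d by auto
  next
    case 2
    then have eq: "2 = 8 * d + 4 * r + 2 * \<epsilon>" using q by simp
    then have "d = 0" "r = 0" "\<epsilon> = 1" using d a eps by presburger+
    moreover from this have "a = 0" "b = 0 \<or> b = 1 \<or> b = 2" using a b 2 by presburger+
    ultimately show ?thesis by auto
  next
    case 3
    then have eq: "6 = 12 * d + 4 * r + 2 * \<epsilon>" using q by simp
    then have "d = 0" "r = 1" "\<epsilon> = 1" using d a eps by presburger+
    moreover from this have "a = 0 \<or> a = 1" "b = 0 \<or> b = 1 \<or> b = 2" using a b 3 by presburger+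
    ultimately show ?thesis by auto
  next
    case 4
    show ?thesis
    \<comment> \<open>For fixed \<open>?s\<close> the right-hand side is least if the lower vertices
      are taken first: then \<open>a\<close> is 0 in the first case and \<open>r - t\<close> with
      \<open>t = q - ?s\<close> in the second.\<close>
    proof (cases "?s \<le> q - r")
      case True
      have "4 * r \<le> q * r" using 4 a by (intro mult_right_mono) linarith+
      also have "\<dots> \<le> q * (q - ?s)" using True 4 by (intro mult_left_mono) linarith+
      finally have "0 \<le> ?s * (q * (q - ?s) - 4 * r)" using a b by simp
      moreover have "0 \<le> 2 * \<epsilon> * (q - ?s)" using eps True a by simp
      \<comment> \<open>Multiplying by \<open>q\<close> lets the equation for \<open>q\<close>
        eliminate \<open>4 * q * d\<close>.\<close>
      moreover have "q * (4 * d * ?s + 2 * \<epsilon> - ?s * (?s - 1))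
          = 2 * \<epsilon> * (q - ?s) + ?s * (q * (q - ?s) - 4 * r)"
        using q by algebra
      ultimately have "0 \<le> q * (4 * d * ?s + 2 * \<epsilon> - ?s * (?s - 1))" by linarith
      then have "0 \<le> 4 * d * ?s + 2 * \<epsilon> - ?s * (?s - 1)"
        using 4 by (simp add: zero_le_mult_iff)
      then show ?thesis using a by linarith
    next
      case False
      \<comment> \<open>\<open>t\<close> counts the vertices outside \<open>S\<close>. Below, the
        slack has the factor \<open>t\<close>, so the bound is attained for \<open>S = Q\<close>,
        that is \<open>t = 0\<close>.\<close>
      define t where "t = q - ?s"
      have t: "0 \<le> t" "t \<le> r - 1" "r - t \<le> a" using False a b unfolding t_def by linarith+
      have "0 \<le> t * (2 * q - 5 - t - 4 * d)"
      proof -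
        define j where "j = q - r"
        have "0 \<le> q * (r - 1 - t)" using 4 t by simp
        moreover have "4 * (j + 1) \<le> q * (j + 1)"
          using 4 r unfolding j_def by (intro mult_right_mono) linarith+
        moreover have "q * (2 * q - 5 - t - 4 * d) = q * (r - 1 - t) + (q * (j + 1) - 4 * j) + 2 * \<epsilon>"
          using q unfolding j_def by algebra
        moreover have "0 \<le> x + (y - 4 * j) + 2 * \<epsilon>" if "0 \<le> x" "4 * (j + 1) \<le> y" for x y :: int
          using that eps by presburger
        ultimately have "0 \<le> q * (2 * q - 5 - t - 4 * d)" by presburger
        then have "0 \<le> 2 * q - 5 - t - 4 * d" using 4 by (simp add: zero_le_mult_iff)
        then show ?thesis using t by simp
      qed
      moreover have "4 * d * ?s + 4 * (r - t) + 2 * \<epsilon> - ?s * (?s - 1) = t * (2 * q - 5 - t - 4 * d)"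
      proof -
        have "?s = q - t" unfolding t_def by simp
        then show ?thesis using q by algebra
      qed
      moreover have "X \<le> D + 4 * a + 2 * \<epsilon>" if "0 \<le> D + 4 * (r - t) + 2 * \<epsilon> - X" for X D
        using that t(3) by presburger
      ultimately show ?thesis by presburger
    qed
  qed
qed

section \<open>Number of edges and the two regimes\<close>

lemma card_edges_complete_split_graph:
  assumes "P \<inter> Q = {}" "finite P" "finite Q"
  shows "card (edges (complete_split_graph P Q)) = card P * card Q + (card P choose 2)"
proof -
  have clique: "{{u, v} |u v. u \<in> P \<and> v \<in> P \<and> u \<noteq> v} = {e. e \<subseteq> P \<and> card e = 2}"
    by (auto simp: card_2_iff)
  have cross: "{{u, v} |u v. u \<in> P \<and> v \<in> Q} = (\<lambda>(u, v). {u, v}) ` (P \<times> Q)" by auto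
  have "inj_on (\<lambda>(u, v). {u, v}) (P \<times> Q)"
    using assms(1) by (auto simp: inj_on_def doubleton_eq_iff)
  then have "card ((\<lambda>(u, v). {u, v}) ` (P \<times> Q)) = card P * card Q"
    by (simp add: card_image card_cartesian_product)
  moreover have "{e. e \<subseteq> P \<and> card e = 2} \<inter> (\<lambda>(u, v). {u, v}) ` (P \<times> Q) = {}"
    using assms(1) by auto
  ultimately show ?thesis
    using assms n_subsets[of P 2] unfolding complete_split_graph_def clique cross
    by (simp add: card_Un_disjoint)
qed

theorem theorem8:
  fixes P Q :: "'a set" and p q m :: nat
  assumes "finite P" and "finite Q" and "P \<inter> Q = {}"
    and "card P = p" and "card Q = q"
    and "p > 0" and "q > 0"
    and "m = card (edges (complete_split_graph P Q))"
  shows "m = p * q + (p choose 2) \<and>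
    (q \<ge> 4 * p + 1 \<longrightarrow>
       associahedron_diameter (complete_split_graph P Q) = enat (2 * p * q + (p choose 2)) \<and>
       int (2 * p * q + (p choose 2)) = 2 * int m - int (p choose 2)) \<and>
    (\<not> q \<ge> 4 * p + 1 \<longrightarrow>
       associahedron_diameter (complete_split_graph P Q)
         = enat (p * q + (q choose 2) div 2 + (p choose 2)) \<and>
       p * q + (q choose 2) div 2 + (p choose 2) \<le> 2 * m)"
proof -
  have m: "m = p * q + (p choose 2)"
    using card_edges_complete_split_graph[of P Q] assms by simp
  have P: "P \<noteq> {}" using assms by auto
  note le = diameter_le[OF assms(3,1,2) P, unfolded assms(4,5)]
  note ge = diameter_ge[OF assms(3,1,2) P, unfolded assms(4,5)]
  have large: "associahedron_diameter (complete_split_graph P Q) = enat (2 * p * q + (p choose 2))"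
    if q: "q \<ge> 4 * p + 1"
  \<comment> \<open>These sizes put all of \<open>Q\<close> above \<open>P\<close> at the end as
    well: \<open>zs\<close> takes the whole of \<open>P\<close>, and \<open>us\<close> is
    empty.\<close>
  proof (rule antisym[OF le(1)], rule ge[of 0 0 p 0])
    fix a b :: nat assume "a \<le> 0" and b: "b \<le> q - 0"
    then have a: "a = 0" and bq: "b \<le> q" by auto
    have "int ((b choose 2) + 2 * p * q) \<le> int ((q choose 2) + 2 * p * b)"
    proof -
      \<comment> \<open>This is twice the slack. At \<open>b = 0\<close> its second factor is
        nonnegative exactly from \<open>4 * p + 1\<close> on, which gives the threshold.\<close>
      have "0 \<le> (int q - int b) * (int q + int b - 1 - 4 * int p)"
        using q bq by (intro mult_nonneg_nonneg) auto
      also have "\<dots> = int q * (int q - 1) - int b * (int b - 1) - 4 * int p * int q + 4 * int p * int b"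
        by algebra
      finally show ?thesis using choose_two_int[of q] choose_two_int[of b] by (simp add: algebra_simps)
    qed
    then have "(b choose 2) + 2 * p * q \<le> (q choose 2) + 2 * p * b" by linarith
    then show "2 * p * q + (p choose 2) + ((a + b) choose 2)
        \<le> a * (0 + p) + b * p + (0 - a) * 0 + (q - 0 - b) * (0 + 0) + (p choose 2) + (q choose 2) + p * (a + b)"
      using a by (simp add: algebra_simps)
  qed simp_all
  have half: "(q choose 2) div 2 \<le> p * q" and
    small: "associahedron_diameter (complete_split_graph P Q)
      = enat (p * q + (q choose 2) div 2 + (p choose 2))"
    if q: "\<not> q \<ge> 4 * p + 1"
  proof -
    define B where "B = (q choose 2) div 2"
    \<comment> \<open>The total height \<open>B\<close> is spread evenly: \<open>r\<close> vertices
      get height \<open>d + 1\<close>, the others \<open>d\<close>.\<close>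
    define d r where "d = B div q" and "r = B mod q"
    \<comment> \<open>One clique vertex separates the two heights; for \<open>r = 0\<close> there is
      only one height and \<open>ys\<close> is empty.\<close>
    define e :: nat where "e = (if r = 0 then 0 else 1)"
    define \<epsilon> where "\<epsilon> = (q choose 2) mod 2"
    have B: "q choose 2 = 2 * B + \<epsilon>" "\<epsilon> \<le> 1" unfolding B_def \<epsilon>_def by auto
    have dr: "B = q * d + r" "r < q" using assms(7) unfolding d_def r_def by auto
    have sq: "int q * (int q - 1) = 4 * int q * int d + 4 * int r + 2 * int \<epsilon>"
      using choose_two_int[of q] B(1) dr(1) by (simp add: algebra_simps)
    \<comment> \<open>From \<open>q \<le> 4 * p\<close> it follows that \<open>B < p * q\<close>, so
      \<open>d < p\<close> and the height \<open>d + 1\<close> fits among the clique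
      vertices.\<close>
    have "int q * (int q - 1) \<le> int q * (4 * int p - 1)"
      using q by (intro mult_left_mono) auto
    then have Bpq: "4 * int B + int q \<le> 4 * (int p * int q)"
      using sq dr(1) by (simp add: algebra_simps)
    then have "int B \<le> int p * int q" by linarith
    then have "B \<le> p * q" by (metis of_nat_le_iff of_nat_mult)
    then show "(q choose 2) div 2 \<le> p * q" unfolding B_def .
    have "int B = int q * int d + int r" using dr(1) by simp
    then have "int q * int d < int q * int p" using Bpq assms(7) unfolding mult.commute[of "int p"] by linarith
    then have dp: "d < p" by (simp add: mult_less_cancel_left)
    show "associahedron_diameter (complete_split_graph P Q)
        = enat (p * q + (q choose 2) div 2 + (p choose 2))"
    proof (rule antisym[OF le(2)], fold B_def, rule ge[of "p - d - e" e d r])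
      show "p - d - e + e + d = p" using dp unfolding e_def by auto
      show "r \<le> q" using dr by simp
      fix a b :: nat assume a: "a \<le> r" and b: "b \<le> q - r"
      have ae: "a * e = a" "r * e = r" using a unfolding e_def by auto
      have "(int a + int b) * (int a + int b - 1) \<le> 4 * int d * (int a + int b) + 4 * int a + 2 * int \<epsilon>"
        using a b dr B(2) sq by (intro balanced_heights_bound[of _ "int r" _ "int q"]) auto
      then have key: "int ((a + b) choose 2) \<le> 2 * (int d * (int a + int b)) + 2 * int a + int \<epsilon>"
        using choose_two_int[of "a + b"] by (simp add: algebra_simps)
      have B': "int B = int q * int d + int r" "int (q choose 2) = 2 * int B + int \<epsilon>"
        using B(1) dr(1) by simp_all
      have x: "int (p - d - e) = int p - int d - int e" using dp unfolding e_def by auto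
      have ae': "int a * int e = int a" "int r * int e = int r" using ae by (metis of_nat_mult)+
      have sub: "int (r - a) = int r - int a" "int (q - r - b) = int q - int r - int b"
        using a b dr(2) by auto
      \<comment> \<open>A vertex of \<open>Q\<close> in \<open>S\<close> contributes
        \<open>p\<close> plus its height, any other \<open>p\<close> minus its height. So the total
        is \<open>p * q\<close> minus \<open>B\<close> plus twice the height inside
        \<open>S\<close>.\<close>
      have "int a * (int e + int d) + int b * int d + (int r - int a) * (int p - int d - int e)
          + (int q - int r - int b) * (int p - int d - int e + int e) + int p * (int a + int b)
          = int p * int q - (int q * int d + int r) + 2 * (int d * (int a + int b)) + 2 * int a"
        using ae' by (auto simp: algebra_simps)
      then have "int (p * q + B + (p choose 2) + ((a + b) choose 2))
          \<le> int (a * (e + d) + b * d + (r - a) * (p - d - e) + (q - r - b) * (p - d - e + e)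
            + (p choose 2) + (q choose 2) + p * (a + b))"
        using key B' unfolding of_nat_add of_nat_mult x sub by linarith
      then show "p * q + B + (p choose 2) + ((a + b) choose 2)
          \<le> a * (e + d) + b * d + (r - a) * (p - d - e) + (q - r - b) * (p - d - e + e)
            + (p choose 2) + (q choose 2) + p * (a + b)"
        by (simp only: of_nat_le_iff)
    qed
  qed
  show ?thesis using m large half small by auto
qed

end
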